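(* Let $M$ be a complex manifold. Then $$c_1^{BC}(M)=0\ \Longrightarrow\ c_1(M)=0\ \Longrightarrow\ c_1^{AC}(M)=0.$$ Moreover, on a (compact) complex manifold $M$ satisfying the $\partial\bar\partial$-lemma, $$c_1^{BC}(M)=0\ \Longleftrightarrow\ c_1(M)=0\ \Longleftrightarrow\ c_1^{AC}(M)=0.$$
   Context: For a complex manifold $M$, the Bott-Chern and Aeppli cohomologies are $$H^{p,q}_{BC}(M)=\frac{\ker d\cap\Omega^{p,q}(M)}{\operatorname{Im}\partial\bar\partial\cap\Omega^{p,q}(M)},\qquad H^{p,q}_A(M)=\frac{\ker\partial\bar\partial\cap\Omega^{p,q}(M)}{\operatorname{Im}\partial\cap\Omega^{p,q}(M)+\operatorname{Im}\bar\partial\cap\Omega^{p,q}(M)}.$$ For any smooth Hermitian metric $h$ on $K_M^{-1}=\wedge^nT^{1,0}M$ ($n=\dim_{\mathbb C}M$), let $\Theta=-\sqrt{-1}\,\partial\bar\partial\log h$ be its (local expression of the) curvature form, a global $d$-closed real $(1,1)$-form. The classes $c_1^{BC}(M)\in H^{1,1}_{BC}(M)$, $c_1(M)\in H^{1,1}_{\bar\partial}(M)$ and $c_1^{AC}(M)\in H^{1,1}_A(M)$ are the classes of $\Theta$ in the respective cohomologies (they do not depend on $h$; no factor $1/2\pi$ is used). A compact complex manifold satisfies the $\partial\bar\partial$-lemma if every form which is $d$-exact, $\partial$-closed and $\bar\partial$-closed is $\partial\bar\partial$-exact. *)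

theory Defs
  imports "HOL-Analysis.Analysis" "HOL-Library.Function_Algebras"
begin

section \<open>Calculus on complex coordinate space\<close>

primrec C_k_on :: "nat \<Rightarrow> 'a::euclidean_space set \<Rightarrow> ('a \<Rightarrow> 'b::real_normed_vector) \<Rightarrow> bool" where
  "C_k_on 0 S f = continuous_on S f"
| "C_k_on (Suc k) S f =
    ((\<forall>x\<in>S. f differentiable (at x)) \<and> (\<forall>v. C_k_on k S (\<lambda>x. frechet_derivative f (at x) v)))"

definition smooth_on :: "'a::euclidean_space set \<Rightarrow> ('a \<Rightarrow> 'b::real_normed_vector) \<Rightarrow> bool" where
  "smooth_on S f \<longleftrightarrow> (\<forall>k. C_k_on k S f)"

text \<open>The index \<open>Inl j\<close> stands for the holomorphic coordinate $z_j$ and \<open>Inr j\<close> for its conjugate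
  $\bar z_j$, so that \<open>wirtinger (Inl j)\<close> is $\partial/\partial z_j$ and \<open>wirtinger (Inr j)\<close> is
  $\partial/\partial\bar z_j$.\<close>

definition wirtinger :: "'n + 'n \<Rightarrow> (complex^'n \<Rightarrow> complex) \<Rightarrow> complex^'n \<Rightarrow> complex" where
  "wirtinger a f z =
    (case a of
       Inl j \<Rightarrow> (frechet_derivative f (at z) (axis j 1) - \<i> * frechet_derivative f (at z) (axis j \<i>)) / 2
     | Inr j \<Rightarrow> (frechet_derivative f (at z) (axis j 1) + \<i> * frechet_derivative f (at z) (axis j \<i>)) / 2)"

definition holomorphic_map_on :: "(complex^'n) set \<Rightarrow> (complex^'n \<Rightarrow> complex^'m) \<Rightarrow> bool" where
  "holomorphic_map_on S f \<longleftrightarrow>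
    smooth_on S f \<and> (\<forall>z\<in>S. \<forall>i j. wirtinger (Inr j) (\<lambda>w. f w $ i) z = 0)"


section \<open>Complex manifolds\<close>

type_synonym ('a, 'n) chart = "'a set \<times> ('a \<Rightarrow> complex^'n)"

definition is_chart :: "'a topology \<Rightarrow> ('a, 'n::finite) chart \<Rightarrow> bool" where
  "is_chart X c \<longleftrightarrow>
    openin X (fst c) \<and> open (snd c ` fst c) \<and>
    homeomorphic_map (subtopology X (fst c)) (top_of_set (snd c ` fst c)) (snd c)"

definition complex_manifold :: "'a topology \<Rightarrow> ('a, 'n::finite) chart set \<Rightarrow> bool" where
  "complex_manifold X A \<longleftrightarrow>
    Hausdorff_space X \<and> second_countable X \<and>
    (\<forall>c\<in>A. is_chart X c) \<and> topspace X = (\<Union>c\<in>A. fst c) \<and>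
    (\<forall>c\<in>A. \<forall>d\<in>A.
       holomorphic_map_on (snd c ` (fst c \<inter> fst d)) (snd d \<circ> inv_into (fst c) (snd c)))"

definition smooth_in_chart :: "('a, 'n::finite) chart \<Rightarrow> ('a \<Rightarrow> 'b::real_normed_vector) \<Rightarrow> bool" where
  "smooth_in_chart c f \<longleftrightarrow> smooth_on (snd c ` fst c) (f \<circ> inv_into (fst c) (snd c))"

definition chart_deriv :: "('a, 'n::finite) chart \<Rightarrow> 'n + 'n \<Rightarrow> ('a \<Rightarrow> complex) \<Rightarrow> 'a \<Rightarrow> complex" where
  "chart_deriv c a f p = wirtinger a (f \<circ> inv_into (fst c) (snd c)) (snd c p)"

definition coord :: "('a, 'n::finite) chart \<Rightarrow> 'n + 'n \<Rightarrow> 'a \<Rightarrow> complex" where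
  "coord c a p = (case a of Inl j \<Rightarrow> snd c p $ j | Inr j \<Rightarrow> cnj (snd c p $ j))"

text \<open>\<open>jac c d p b a\<close> is the derivative of the \<open>b\<close>-th coordinate of \<open>d\<close> in the direction of the
  \<open>a\<close>-th coordinate vector field of \<open>c\<close>.\<close>

definition jac :: "('a, 'n::finite) chart \<Rightarrow> ('a, 'n) chart \<Rightarrow> 'a \<Rightarrow> 'n + 'n \<Rightarrow> 'n + 'n \<Rightarrow> complex" where
  "jac c d p b a = chart_deriv c a (coord d b) p"


section \<open>Complex differential forms\<close>

text \<open>A complex-valued form \<open>\<omega>\<close> is given by its components: \<open>\<omega> c p [a\<^sub>1, \<dots>, a\<^sub>k]\<close> is the
  value at \<open>p\<close> of its degree \<open>k\<close> part on the coordinate vectors of the complexified tangent space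
  ($\partial/\partial z_j$ or $\partial/\partial\bar z_j$) of the chart \<open>c\<close> that \<open>a\<^sub>1, \<dots>, a\<^sub>k\<close> name.
  Components that have no meaning (\<open>c\<close> not in the atlas, or \<open>p\<close> not in its domain) are set to 0,
  so that equality of forms is equality of functions. Forms may be of mixed degree.\<close>

type_synonym ('a, 'n) form = "('a, 'n) chart \<Rightarrow> 'a \<Rightarrow> ('n + 'n) list \<Rightarrow> complex"

definition forms :: "('a, 'n::finite) chart set \<Rightarrow> ('a, 'n) form set" where
  "forms A = {\<omega>.
    (\<forall>c p l. \<not> (c \<in> A \<and> p \<in> fst c) \<longrightarrow> \<omega> c p l = 0) \<and>
    (\<forall>c p l i j. i < j \<and> j < length l \<longrightarrow> \<omega> c p (l[i := l ! j, j := l ! i]) = - \<omega> c p l) \<and>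
    (\<forall>c\<in>A. \<forall>l. smooth_in_chart c (\<lambda>p. \<omega> c p l)) \<and>
    (\<forall>c\<in>A. \<forall>d\<in>A. \<forall>p \<in> fst c \<inter> fst d. \<forall>l.
       \<omega> c p l = (\<Sum>m | length m = length l. (\<Prod>i<length l. jac c d p (m ! i) (l ! i)) * \<omega> d p m))}"

definition forms_pq :: "('a, 'n::finite) chart set \<Rightarrow> nat \<Rightarrow> nat \<Rightarrow> ('a, 'n) form set" where
  "forms_pq A p q = {\<omega> \<in> forms A. \<forall>c x l. \<omega> c x l \<noteq> 0 \<longrightarrow>
     length (filter isl l) = p \<and> length (filter (\<lambda>a. \<not> isl a) l) = q}"

text \<open>The exterior derivative in coordinates,
  $(d\omega)(X_0,\dots,X_k) = \sum_i (-1)^i X_i\,\omega(X_0,\dots,\widehat{X_i},\dots,X_k)$ for coordinate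
  vector fields $X_i$, with the sum restricted to those $X_i$ whose index satisfies \<open>P\<close>: all of them
  for $d$, the $\partial/\partial z_j$ for $\partial$, the $\partial/\partial\bar z_j$ for $\bar\partial$.\<close>

definition d_part ::
  "('n + 'n \<Rightarrow> bool) \<Rightarrow> ('a, 'n::finite) chart set \<Rightarrow> ('a, 'n) form \<Rightarrow> ('a, 'n) form" where
  "d_part P A \<omega> = (\<lambda>c p l.
    if c \<in> A \<and> p \<in> fst c
    then \<Sum>i | i < length l \<and> P (l ! i).
           (-1) ^ i * chart_deriv c (l ! i) (\<lambda>q. \<omega> c q (take i l @ drop (Suc i) l)) p
    else 0)"

definition ext_d :: "('a, 'n::finite) chart set \<Rightarrow> ('a, 'n) form \<Rightarrow> ('a, 'n) form" where
  "ext_d = d_part (\<lambda>_. True)"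

definition del :: "('a, 'n::finite) chart set \<Rightarrow> ('a, 'n) form \<Rightarrow> ('a, 'n) form" where
  "del = d_part isl"

definition delbar :: "('a, 'n::finite) chart set \<Rightarrow> ('a, 'n) form \<Rightarrow> ('a, 'n) form" where
  "delbar = d_part (\<lambda>a. \<not> isl a)"

definition ddbar_lemma :: "('a, 'n::finite) chart set \<Rightarrow> bool" where
  "ddbar_lemma A \<longleftrightarrow>
    (\<forall>\<omega> \<in> forms A. \<omega> \<in> ext_d A ` forms A \<and> del A \<omega> = 0 \<and> delbar A \<omega> = 0
       \<longrightarrow> \<omega> \<in> (\<lambda>\<eta>. del A (delbar A \<eta>)) ` forms A)"


section \<open>Cohomology groups\<close>

definition cohomology :: "('a, 'n) form set \<Rightarrow> ('a, 'n) form set \<Rightarrow> ('a, 'n) form set set" where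
  "cohomology Z B = Z // {(\<omega>, \<eta>). \<omega> \<in> Z \<and> \<eta> \<in> Z \<and> \<eta> - \<omega> \<in> B}"

text \<open>A cohomology group is a partition of the space of closed forms; \<open>cclass H \<omega>\<close> is the
  block of \<open>H\<close> containing the closed form \<open>\<omega>\<close>. The zero element of \<open>H\<close> is \<open>cclass H 0\<close>.\<close>

definition cclass :: "('a, 'n) form set set \<Rightarrow> ('a, 'n) form \<Rightarrow> ('a, 'n) form set" where
  "cclass H \<omega> = \<Union>{C \<in> H. \<omega> \<in> C}"

definition H_BC :: "('a, 'n::finite) chart set \<Rightarrow> nat \<Rightarrow> nat \<Rightarrow> ('a, 'n) form set set" where
  "H_BC A p q = cohomology
     {\<omega> \<in> forms_pq A p q. ext_d A \<omega> = 0}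
     ((\<lambda>\<eta>. del A (delbar A \<eta>)) ` forms A \<inter> forms_pq A p q)"

definition H_delbar :: "('a, 'n::finite) chart set \<Rightarrow> nat \<Rightarrow> nat \<Rightarrow> ('a, 'n) form set set" where
  "H_delbar A p q = cohomology
     {\<omega> \<in> forms_pq A p q. delbar A \<omega> = 0}
     (delbar A ` forms A \<inter> forms_pq A p q)"

definition H_A :: "('a, 'n::finite) chart set \<Rightarrow> nat \<Rightarrow> nat \<Rightarrow> ('a, 'n) form set set" where
  "H_A A p q = cohomology
     {\<omega> \<in> forms_pq A p q. del A (delbar A \<omega>) = 0}
     {\<alpha> + \<beta> | \<alpha> \<beta>. \<alpha> \<in> del A ` forms A \<inter> forms_pq A p q \<and> \<beta> \<in> delbar A ` forms A \<inter> forms_pq A p q}"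


section \<open>The anticanonical bundle and the first Chern classes\<close>

text \<open>A Hermitian metric on the anticanonical line bundle $K_M^{-1} = \wedge^n T^{1,0}M$ is given by
  the squared norms \<open>h c p\<close> of its coordinate frames
  $\partial/\partial z_1 \wedge \dots \wedge \partial/\partial z_n$. The frame of \<open>c\<close> is
  $\det(\partial w_i/\partial z_j)$ times the frame of a chart \<open>d\<close> with coordinates $w$.\<close>

definition hermitian_metrics :: "('a, 'n::finite) chart set \<Rightarrow> (('a, 'n) chart \<Rightarrow> 'a \<Rightarrow> real) set" where
  "hermitian_metrics A = {h.
    (\<forall>c\<in>A. smooth_in_chart c (h c) \<and> (\<forall>p\<in>fst c. h c p > 0)) \<and>
    (\<forall>c\<in>A. \<forall>d\<in>A. \<forall>p \<in> fst c \<inter> fst d.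
       h c p = (cmod (det (\<chi> i j. jac c d p (Inl i) (Inl j))))\<^sup>2 * h d p)}"

text \<open>$\Theta = -\sqrt{-1}\,\partial\bar\partial\log h$. The local functions $\log h$ do not glue to a
  form, but \<open>del\<close> and \<open>delbar\<close> act chart by chart.\<close>

definition curvature :: "('a, 'n::finite) chart set \<Rightarrow> (('a, 'n) chart \<Rightarrow> 'a \<Rightarrow> real) \<Rightarrow> ('a, 'n) form" where
  "curvature A h = (\<lambda>c p l.
     - \<i> * del A (delbar A (\<lambda>c p l. if l = [] then complex_of_real (ln (h c p)) else 0)) c p l)"

text \<open>The class of the curvature form is the same for all metrics \<open>h\<close>, so each union below is that
  one common class.\<close>

definition c1_BC :: "('a, 'n::finite) chart set \<Rightarrow> ('a, 'n) form set" where
  "c1_BC A = (\<Union>h \<in> hermitian_metrics A. cclass (H_BC A 1 1) (curvature A h))"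

definition c1 :: "('a, 'n::finite) chart set \<Rightarrow> ('a, 'n) form set" where
  "c1 A = (\<Union>h \<in> hermitian_metrics A. cclass (H_delbar A 1 1) (curvature A h))"

definition c1_AC :: "('a, 'n::finite) chart set \<Rightarrow> ('a, 'n) form set" where
  "c1_AC A = (\<Union>h \<in> hermitian_metrics A. cclass (H_A A 1 1) (curvature A h))"

end

theory Submission
  imports Defs
begin

text \<open>
  The class of a closed form vanishes exactly when the form is exact, so the theorem compares three
  notions of exactness for the curvature $\Theta$, a form of bidegree $(1,1)$ with
  $\partial\Theta = \bar\partial\Theta = 0$: lying in the image of $\partial\bar\partial$, in the image
  of $\bar\partial$, or in the sum of the images of $\partial$ and $\bar\partial$. The Chern classes
  are unions over all metrics, to which a curvature contributes only as a closed global form of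
  bidegree $(1,1)$. By \<open>union_of_classes_eq_zero_iff\<close> such a union is the zero class if and only if
  there are contributing curvatures and all of them are exact.

  The first notion implies the second, because $\partial\bar\partial f = \bar\partial(-\partial f)$
  (\<open>del_delbar_exact_imp_delbar_exact\<close>), and the second trivially implies the third.

  Under the $\partial\bar\partial$-lemma the third implies the first
  (\<open>aeppli_exact_imp_del_delbar_exact\<close>). Let $\Theta = \partial\alpha + \bar\partial\beta$ with
  $\alpha$ of bidegree $(0,1)$ and $\beta$ of bidegree $(1,0)$, and put $\eta = \alpha + \beta$. The form
  $d\eta$ is $d$-exact, and $\partial d\eta = \partial\bar\partial\eta = -\bar\partial d\eta$ vanishes,
  since $\partial\bar\partial\beta = \partial\Theta = 0$ and
  $\partial\bar\partial\alpha = -\bar\partial\Theta = 0$. Hence $d\eta = \partial\bar\partial\gamma$, and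
  the $(1,1)$ part of this equation reads $\Theta = \partial\bar\partial\gamma_{0,0}$.

  The argument rests on three facts about forms given by components in charts. The operators
  $\partial$ and $\bar\partial$ anticommute and square to zero (\<open>d_part_anticommute\<close>), by the symmetry
  of second derivatives. The part of a form of given bidegree is again a form
  (\<open>forms_bidegree_part\<close>), because transition maps are holomorphic. The exterior derivative of a
  function or of a one-form satisfies the transformation law of a form (\<open>ext_d_function_in_forms\<close>,
  \<open>ext_d_one_form_in_forms\<close>), by the chain rule and again the symmetry of second derivatives.
\<close>

section \<open>Smooth functions on open sets\<close>

lemma C_k_on_cong:
  assumes "open S" "\<And>x. x \<in> S \<Longrightarrow> f x = g x" "C_k_on k S f"
  shows "C_k_on k S g"
  using assms
proof (induction k arbitrary: f g)
  case 0
  then show ?case by (auto cong: continuous_on_cong)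
next
  case (Suc k)
  have df: "f differentiable (at x)" if "x \<in> S" for x
    using Suc.prems(3) that by simp
  have "g differentiable (at x)" if "x \<in> S" for x
    using has_derivative_transform_within_open[where f = f and g = g, OF _ \<open>open S\<close> that] Suc.prems(2) df[OF that]
    unfolding differentiable_def by blast
  moreover have "C_k_on k S (\<lambda>x. frechet_derivative g (at x) v)" for v
  proof (rule Suc.IH[OF \<open>open S\<close>])
    show "frechet_derivative f (at x) v = frechet_derivative g (at x) v" if "x \<in> S" for x
      using frechet_derivative_transform_within_open[OF df[OF that] \<open>open S\<close> that, of g] Suc.prems(2)
      by auto
    show "C_k_on k S (\<lambda>x. frechet_derivative f (at x) v)"
      using Suc.prems(3) by simp
  qed
  ultimately show ?case by simp
qed

lemma C_k_on_SucD: "C_k_on (Suc k) S f \<Longrightarrow> C_k_on k S f"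
proof (induction k arbitrary: f)
  case 0
  then show ?case
    by (auto intro!: continuous_at_imp_continuous_on differentiable_imp_continuous_within)
next
  case (Suc k)
  then show ?case by (metis C_k_on.simps(2))
qed

text \<open>The recursion in \<open>C_k_on\<close> speaks of the chosen derivative \<open>frechet_derivative\<close>. Working with an
  explicit derivative \<open>f'\<close> instead lets the differentiation rules of the library drive the inductions
  below.\<close>

lemma C_k_on_SucI:
  assumes "open S" "\<And>x. x \<in> S \<Longrightarrow> (f has_derivative f' x) (at x)"
    and "\<And>v. C_k_on k S (\<lambda>x. f' x v)"
  shows "C_k_on (Suc k) S f"
proof -
  have "C_k_on k S (\<lambda>x. frechet_derivative f (at x) v)" for v
    by (rule C_k_on_cong[OF assms(1) _ assms(3)[of v]])
       (use frechet_derivative_at[OF assms(2)] in auto)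
  moreover have "f differentiable (at x)" if "x \<in> S" for x
    using assms(2)[OF that] by (auto simp: differentiable_def)
  ultimately show ?thesis by simp
qed

lemma C_k_on_has_derivative:
  assumes "C_k_on (Suc k) S f" "x \<in> S"
  shows "(f has_derivative frechet_derivative f (at x)) (at x)"
  using assms by (simp add: frechet_derivative_works[symmetric])

lemma C_k_on_add:
  assumes "open S" "C_k_on k S f" "C_k_on k S g"
  shows "C_k_on k S (\<lambda>x. f x + g x)"
  using assms
proof (induction k arbitrary: f g)
  case 0
  then show ?case by (auto intro: continuous_on_add)
next
  case (Suc k)
  show ?case
    by (rule C_k_on_SucI[OF \<open>open S\<close>
          has_derivative_add[OF C_k_on_has_derivative[OF Suc.prems(2)] C_k_on_has_derivative[OF Suc.prems(3)]]])
       (use Suc in auto)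
qed

lemma C_k_on_bounded_linear:
  assumes "bounded_linear L" "open S" "C_k_on k S f"
  shows "C_k_on k S (\<lambda>x. L (f x))"
  using assms
proof (induction k arbitrary: f)
  case 0
  then show ?case by (auto intro: bounded_linear.continuous_on)
next
  case (Suc k)
  show ?case
    by (rule C_k_on_SucI[OF \<open>open S\<close>
          bounded_linear.has_derivative[OF Suc.prems(1) C_k_on_has_derivative[OF Suc.prems(3)]]])
       (use Suc in auto)
qed

text \<open>The Leibniz rule expresses the derivative of a product through products of functions that are
  \<open>k\<close> times differentiable, so the induction must be over all pairs of factors.\<close>

lemma C_k_on_mult:
  fixes f g :: "'a::euclidean_space \<Rightarrow> 'b::real_normed_algebra"
  assumes "open S" "C_k_on k S f" "C_k_on k S g"
  shows "C_k_on k S (\<lambda>x. f x * g x)"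
  using assms
proof (induction k arbitrary: f g)
  case 0
  then show ?case by (auto intro: continuous_on_mult)
next
  case (Suc k)
  have "C_k_on k S (\<lambda>x. f x * frechet_derivative g (at x) v)"
    "C_k_on k S (\<lambda>x. frechet_derivative f (at x) v * g x)" for v
    using Suc.prems by (auto intro!: Suc.IH intro: C_k_on_SucD)
  then show ?case
    by (intro C_k_on_SucI[OF \<open>open S\<close>
          has_derivative_mult[OF C_k_on_has_derivative[OF Suc.prems(2)] C_k_on_has_derivative[OF Suc.prems(3)]]]
          C_k_on_add \<open>open S\<close>)
qed

text \<open>The derivative of \<open>1/f\<close> is \<open>- (1/f) f' (1/f)\<close>, in which \<open>1/f\<close> is \<open>C\<^sup>k\<close> by the induction
  hypothesis.\<close>

lemma C_k_on_inverse:
  fixes f :: "'a::euclidean_space \<Rightarrow> real"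
  assumes "open S" "C_k_on k S f" "\<And>x. x \<in> S \<Longrightarrow> f x \<noteq> 0"
  shows "C_k_on k S (\<lambda>x. inverse (f x))"
  using assms
proof (induction k)
  case 0
  then show ?case by (auto intro: continuous_on_inverse)
next
  case (Suc k)
  have inv: "C_k_on k S (\<lambda>x. inverse (f x))"
    using Suc C_k_on_SucD by blast
  have "C_k_on k S (\<lambda>x. inverse (f x) * frechet_derivative f (at x) v * inverse (f x))" for v
    using Suc.prems by (intro C_k_on_mult inv \<open>open S\<close>) auto
  from C_k_on_bounded_linear[OF bounded_linear_minus[OF bounded_linear_ident] \<open>open S\<close> this] show ?case
    by (intro C_k_on_SucI[OF \<open>open S\<close> Deriv.has_derivative_inverse[OF Suc.prems(3) C_k_on_has_derivative[OF Suc.prems(2)]]])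
qed

text \<open>Needed because the local potentials of the curvature are logarithms of the metric. The derivative
  \<open>f' / f\<close> contains no logarithm, so no induction is necessary.\<close>

lemma C_k_on_ln:
  fixes f :: "'a::euclidean_space \<Rightarrow> real"
  assumes "open S" "C_k_on k S f" "\<And>x. x \<in> S \<Longrightarrow> f x > 0"
  shows "C_k_on k S (\<lambda>x. ln (f x))"
proof (cases k)
  case 0
  with assms show ?thesis by (force intro!: continuous_on_ln)
next
  case (Suc m)
  have f: "C_k_on (Suc m) S f" using assms(2) Suc by simp
  have "C_k_on m S (\<lambda>x. frechet_derivative f (at x) v * inverse (f x))" for v
    using f assms C_k_on_SucD[OF f] by (intro C_k_on_mult C_k_on_inverse) fastforce+
  then have "C_k_on (Suc m) S (\<lambda>x. ln (f x))"
    by (intro C_k_on_SucI[OF \<open>open S\<close> has_derivative_ln[OF assms(3) C_k_on_has_derivative[OF f]]])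
  with Suc show ?thesis by simp
qed

lemma smooth_on_cong:
  "open S \<Longrightarrow> (\<And>x. x \<in> S \<Longrightarrow> f x = g x) \<Longrightarrow> smooth_on S f \<Longrightarrow> smooth_on S g"
  unfolding smooth_on_def using C_k_on_cong by blast

lemma smooth_on_add:
  "open S \<Longrightarrow> smooth_on S f \<Longrightarrow> smooth_on S g \<Longrightarrow> smooth_on S (\<lambda>x. f x + g x)"
  unfolding smooth_on_def using C_k_on_add by blast

lemma smooth_on_bounded_linear:
  "bounded_linear L \<Longrightarrow> open S \<Longrightarrow> smooth_on S f \<Longrightarrow> smooth_on S (\<lambda>x. L (f x))"
  unfolding smooth_on_def using C_k_on_bounded_linear by blast

lemma smooth_on_ln:
  fixes f :: "'a::euclidean_space \<Rightarrow> real"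
  shows "open S \<Longrightarrow> smooth_on S f \<Longrightarrow> (\<And>x. x \<in> S \<Longrightarrow> f x > 0) \<Longrightarrow> smooth_on S (\<lambda>x. ln (f x))"
  unfolding smooth_on_def using C_k_on_ln by blast

lemma smooth_on_deriv: "smooth_on S f \<Longrightarrow> smooth_on S (\<lambda>x. frechet_derivative f (at x) v)"
  unfolding smooth_on_def by (metis C_k_on.simps(2))

lemma smooth_on_differentiable: "smooth_on S f \<Longrightarrow> x \<in> S \<Longrightarrow> f differentiable (at x)"
  unfolding smooth_on_def by (metis C_k_on.simps(2))

lemma smooth_on_continuous: "smooth_on S f \<Longrightarrow> continuous_on S f"
  unfolding smooth_on_def by (metis C_k_on.simps(1))

lemma smooth_on_has_derivative:
  "smooth_on S f \<Longrightarrow> x \<in> S \<Longrightarrow> (f has_derivative frechet_derivative f (at x)) (at x)"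
  using smooth_on_differentiable frechet_derivative_works by blast

lemma smooth_on_zero: "open S \<Longrightarrow> smooth_on S (\<lambda>x. 0)"
proof -
  have "C_k_on k S (\<lambda>x. 0)" for k by (induction k) auto
  then show ?thesis unfolding smooth_on_def by blast
qed

lemma smooth_on_sum:
  assumes "open S" "\<And>i. i \<in> I \<Longrightarrow> smooth_on S (f i)"
  shows "smooth_on S (\<lambda>x. \<Sum>i\<in>I. f i x)"
  using assms(2)
  by (induction I rule: infinite_finite_induct) (auto intro: smooth_on_zero smooth_on_add assms(1))

section \<open>Symmetry of second derivatives\<close>

text \<open>The mean value theorem, applied first in the direction \<open>u\<close> to the increment of \<open>f\<close> along \<open>h v\<close> and
  then in the direction \<open>v\<close> to the partial derivative along \<open>u\<close>. The left-hand side is symmetric in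
  \<open>u\<close> and \<open>v\<close>, which is what makes mixed derivatives agree.\<close>

lemma second_difference_mean_value:
  fixes f :: "'a::euclidean_space \<Rightarrow> real"
  assumes f: "smooth_on S f" and h: "h > 0"
    and S: "\<And>s t. 0 \<le> s \<Longrightarrow> s \<le> h \<Longrightarrow> 0 \<le> t \<Longrightarrow> t \<le> h \<Longrightarrow> z + s *\<^sub>R u + t *\<^sub>R v \<in> S"
  obtains s t where "0 < s" "s < h" "0 < t" "t < h"
    "f (z + h *\<^sub>R u + h *\<^sub>R v) - f (z + h *\<^sub>R u) - f (z + h *\<^sub>R v) + f z =
     h * h * frechet_derivative (\<lambda>x. frechet_derivative f (at x) u) (at (z + s *\<^sub>R u + t *\<^sub>R v)) v"
proof -
  let ?fu = "\<lambda>x. frechet_derivative f (at x) u"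
  have fu: "smooth_on S ?fu" by (rule smooth_on_deriv[OF f])
  have deru: "((\<lambda>s. g (z + s *\<^sub>R u + t *\<^sub>R v)) has_real_derivative
      frechet_derivative g (at (z + s *\<^sub>R u + t *\<^sub>R v)) u) (at s)"
    if g: "smooth_on S g" and "0 \<le> s" "s \<le> h" "0 \<le> t" "t \<le> h" for g :: "'a \<Rightarrow> real" and s t
  proof -
    let ?x = "z + s *\<^sub>R u + t *\<^sub>R v"
    have "((\<lambda>s. z + s *\<^sub>R u + t *\<^sub>R v) has_derivative (\<lambda>r. r *\<^sub>R u)) (at s)"
      by (auto intro!: derivative_eq_intros)
    from has_derivative_compose[OF this smooth_on_has_derivative[OF g S[OF that(2-5)]]]
    have "((\<lambda>s. g (z + s *\<^sub>R u + t *\<^sub>R v)) has_derivative (\<lambda>r. frechet_derivative g (at ?x) (r *\<^sub>R u))) (at s)" .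
    then show ?thesis
      by (rule has_derivative_imp_has_field_derivative)
         (simp add: linear_cmul[OF linear_frechet_derivative[OF smooth_on_differentiable[OF g S[OF that(2-5)]]]])
  qed
  have derv: "((\<lambda>t. g (z + s *\<^sub>R u + t *\<^sub>R v)) has_real_derivative
      frechet_derivative g (at (z + s *\<^sub>R u + t *\<^sub>R v)) v) (at t)"
    if g: "smooth_on S g" and "0 \<le> s" "s \<le> h" "0 \<le> t" "t \<le> h" for g :: "'a \<Rightarrow> real" and s t
  proof -
    let ?x = "z + s *\<^sub>R u + t *\<^sub>R v"
    have "((\<lambda>t. z + s *\<^sub>R u + t *\<^sub>R v) has_derivative (\<lambda>r. r *\<^sub>R v)) (at t)"
      by (auto intro!: derivative_eq_intros)
    from has_derivative_compose[OF this smooth_on_has_derivative[OF g S[OF that(2-5)]]]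
    have "((\<lambda>t. g (z + s *\<^sub>R u + t *\<^sub>R v)) has_derivative (\<lambda>r. frechet_derivative g (at ?x) (r *\<^sub>R v))) (at t)" .
    then show ?thesis
      by (rule has_derivative_imp_has_field_derivative)
         (simp add: linear_cmul[OF linear_frechet_derivative[OF smooth_on_differentiable[OF g S[OF that(2-5)]]]])
  qed
  define F where "F s = f (z + s *\<^sub>R u + h *\<^sub>R v) - f (z + s *\<^sub>R u + 0 *\<^sub>R v)" for s
  have "\<exists>s>0. s < h \<and> F h - F 0 = (h - 0) *
      (?fu (z + s *\<^sub>R u + h *\<^sub>R v) - ?fu (z + s *\<^sub>R u + 0 *\<^sub>R v))"
    unfolding F_def by (rule MVT2[OF h]) (intro DERIV_diff deru f; use h in simp)
  then obtain s where s: "0 < s" "s < h" and F: "F h - F 0 = h *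
      (?fu (z + s *\<^sub>R u + h *\<^sub>R v) - ?fu (z + s *\<^sub>R u + 0 *\<^sub>R v))" by auto
  have "\<exists>t>0. t < h \<and> ?fu (z + s *\<^sub>R u + h *\<^sub>R v) - ?fu (z + s *\<^sub>R u + 0 *\<^sub>R v) = (h - 0) *
      frechet_derivative ?fu (at (z + s *\<^sub>R u + t *\<^sub>R v)) v"
    by (rule MVT2[OF h]) (intro derv fu; use h s in simp)
  then obtain t where t: "0 < t" "t < h" and G: "?fu (z + s *\<^sub>R u + h *\<^sub>R v) - ?fu (z + s *\<^sub>R u + 0 *\<^sub>R v) = h *
      frechet_derivative ?fu (at (z + s *\<^sub>R u + t *\<^sub>R v)) v" by auto
  show ?thesis
    by (rule that[OF s t]) (use F G in \<open>simp add: F_def algebra_simps\<close>)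
qed

text \<open>The same second difference divided by \<open>h\<^sup>2\<close> is a value of either mixed derivative at a point close
  to \<open>z\<close>; continuity of both forces their values at \<open>z\<close> to agree.\<close>

lemma second_derivative_symmetric_real:
  fixes f :: "'a::euclidean_space \<Rightarrow> real"
  assumes S: "open S" and f: "smooth_on S f" and z: "z \<in> S"
  shows "frechet_derivative (\<lambda>x. frechet_derivative f (at x) u) (at z) v =
         frechet_derivative (\<lambda>x. frechet_derivative f (at x) v) (at z) u"
proof -
  define Fuv where "Fuv = (\<lambda>x. frechet_derivative (\<lambda>x. frechet_derivative f (at x) u) (at x) v)"
  define Fvu where "Fvu = (\<lambda>x. frechet_derivative (\<lambda>x. frechet_derivative f (at x) v) (at x) u)"
  have "smooth_on S Fuv" "smooth_on S Fvu"
    unfolding Fuv_def Fvu_def by (intro smooth_on_deriv f)+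
  then have cont: "isCont Fuv z" "isCont Fvu z"
    using S z smooth_on_continuous continuous_on_eq_continuous_at by blast+
  have "dist (Fuv z) (Fvu z) < e" if e: "e > 0" for e
  proof -
    have "\<forall>\<^sub>F x in nhds z. x \<in> S \<and> dist (Fuv x) (Fuv z) < e/2 \<and> dist (Fvu x) (Fvu z) < e/2"
      using cont e S z
      by (intro eventually_conj eventually_nhds_in_open tendstoD)
         (auto simp: isCont_def tendsto_at_iff_tendsto_nhds)
    then obtain d where d: "d > 0" and nb: "\<And>x. dist x z < d \<Longrightarrow>
        x \<in> S \<and> dist (Fuv x) (Fuv z) < e/2 \<and> dist (Fvu x) (Fvu z) < e/2"
      unfolding eventually_nhds_metric by blast
    \<comment> \<open>small enough for the parallelogram spanned by \<open>h u\<close> and \<open>h v\<close> at \<open>z\<close> to lie in the \<open>d\<close>-ball; the \<open>1\<close> covers \<open>u = v = 0\<close>\<close>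
    define h where "h = d / (2 * (norm u + norm v + 1))"
    have pos: "norm u + norm v + 1 > 0" by (smt (verit) norm_ge_zero)
    have h: "h > 0" unfolding h_def using d pos by simp
    have near: "dist (z + s *\<^sub>R u + t *\<^sub>R v) z < d" if "0 \<le> s" "s \<le> h" "0 \<le> t" "t \<le> h" for s t
    proof -
      have "dist (z + s *\<^sub>R u + t *\<^sub>R v) z = norm (s *\<^sub>R u + t *\<^sub>R v)" by (simp add: dist_norm add.assoc)
      also have "\<dots> \<le> s * norm u + t * norm v"
        using norm_triangle_ineq[of "s *\<^sub>R u" "t *\<^sub>R v"] that by simp
      also have "\<dots> \<le> h * norm u + h * norm v"
        using that by (intro add_mono mult_right_mono) auto
      also have "\<dots> < 2 * h * (norm u + norm v + 1)"
        using h by (simp add: algebra_simps add_pos_nonneg add_nonneg_pos)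
      also have "\<dots> = d" unfolding h_def using pos by (simp add: field_simps)
      finally show ?thesis .
    qed
    obtain s t where st: "0 < s" "s < h" "0 < t" "t < h" and
      1: "f (z + h *\<^sub>R u + h *\<^sub>R v) - f (z + h *\<^sub>R u) - f (z + h *\<^sub>R v) + f z =
          h * h * Fuv (z + s *\<^sub>R u + t *\<^sub>R v)"
      unfolding Fuv_def by (rule second_difference_mean_value[OF f h, of z u v]) (use nb near in blast)+
    obtain s' t' where st': "0 < s'" "s' < h" "0 < t'" "t' < h" and
      2: "f (z + h *\<^sub>R v + h *\<^sub>R u) - f (z + h *\<^sub>R v) - f (z + h *\<^sub>R u) + f z =
          h * h * Fvu (z + s' *\<^sub>R v + t' *\<^sub>R u)"
      unfolding Fvu_def
      by (rule second_difference_mean_value[OF f h, of z v u])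
         (use nb near in \<open>auto simp: add.assoc add.commute[of "_ *\<^sub>R v"]\<close>)
    have "h * h * Fuv (z + s *\<^sub>R u + t *\<^sub>R v) = h * h * Fvu (z + t' *\<^sub>R u + s' *\<^sub>R v)"
      using 1 2 by (simp add: algebra_simps)
    then have eq: "Fuv (z + s *\<^sub>R u + t *\<^sub>R v) = Fvu (z + t' *\<^sub>R u + s' *\<^sub>R v)"
      using h by simp
    have "dist (Fuv (z + s *\<^sub>R u + t *\<^sub>R v)) (Fuv z) < e/2" "dist (Fvu (z + t' *\<^sub>R u + s' *\<^sub>R v)) (Fvu z) < e/2"
      using nb near st st' by auto
    then show ?thesis using eq dist_triangle_half_l[of _ _ e] by (metis dist_commute)
  qed
  then show ?thesis
    unfolding Fuv_def Fvu_def by (metis dist_self less_irrefl zero_less_dist_iff)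
qed

lemma frechet_derivative_bounded_linear:
  assumes "bounded_linear L" "f differentiable (at x)"
  shows "frechet_derivative (\<lambda>x. L (f x)) (at x) v = L (frechet_derivative f (at x) v)"
  using frechet_derivative_at[OF bounded_linear.has_derivative[OF assms(1) assms(2)[unfolded frechet_derivative_works]]]
  by metis

text \<open>The mean value theorem needs real values, so the symmetry is transferred one component at a time.\<close>

lemma second_derivative_symmetric:
  fixes f :: "'a::euclidean_space \<Rightarrow> 'b::euclidean_space"
  assumes S: "open S" and f: "smooth_on S f" and z: "z \<in> S"
  shows "frechet_derivative (\<lambda>x. frechet_derivative f (at x) u) (at z) v =
         frechet_derivative (\<lambda>x. frechet_derivative f (at x) v) (at z) u"
proof (rule euclidean_eqI)
  fix b :: 'b
  let ?L = "\<lambda>y. y \<bullet> b"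
  have L: "bounded_linear ?L" by (rule bounded_linear_inner_left)
  have comm: "frechet_derivative (\<lambda>x. frechet_derivative (\<lambda>x. ?L (f x)) (at x) u) (at z) v =
      ?L (frechet_derivative (\<lambda>x. frechet_derivative f (at x) u) (at z) v)" for u v
  proof -
    have fu: "(\<lambda>x. frechet_derivative f (at x) u) differentiable (at z)"
      by (rule smooth_on_differentiable[OF smooth_on_deriv[OF f] z])
    have "frechet_derivative (\<lambda>x. ?L (frechet_derivative f (at x) u)) (at z) =
          frechet_derivative (\<lambda>x. frechet_derivative (\<lambda>x. ?L (f x)) (at x) u) (at z)"
    proof (rule frechet_derivative_transform_within_open[OF _ S z])
      show "(\<lambda>x. ?L (frechet_derivative f (at x) u)) differentiable (at z)"
        using bounded_linear.has_derivative[OF L fu[unfolded frechet_derivative_works]]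
        by (auto simp: differentiable_def)
      show "?L (frechet_derivative f (at x) u) = frechet_derivative (\<lambda>x. ?L (f x)) (at x) u" if "x \<in> S" for x
        by (rule frechet_derivative_bounded_linear[OF L smooth_on_differentiable[OF f that], symmetric])
    qed
    then show ?thesis using frechet_derivative_bounded_linear[OF L fu] by simp
  qed
  show "?L (frechet_derivative (\<lambda>x. frechet_derivative f (at x) u) (at z) v) =
        ?L (frechet_derivative (\<lambda>x. frechet_derivative f (at x) v) (at z) u)"
    using second_derivative_symmetric_real[OF S smooth_on_bounded_linear[OF L S f] z] comm by metis
qed


section \<open>Wirtinger derivatives\<close>

text \<open>Functions that agree near a point have the same derivatives there, if any, hence in every case the
  same value of the choice operator in \<open>frechet_derivative\<close>.\<close>

lemma frechet_derivative_cong_open: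
  assumes "open S" "z \<in> S" "\<And>x. x \<in> S \<Longrightarrow> f x = g x"
  shows "frechet_derivative f (at z) = frechet_derivative g (at z)"
proof -
  have "(f has_derivative D) (at z) \<longleftrightarrow> (g has_derivative D) (at z)" for D
    using has_derivative_transform_within_open[OF _ assms(1,2), of f D UNIV g]
      has_derivative_transform_within_open[OF _ assms(1,2), of g D UNIV f] assms(3) by metis
  then show ?thesis unfolding frechet_derivative_def by simp
qed

text \<open>The value, on a coordinate vector of the complexified tangent space, of the complex-linear extension
  of a real-linear map. It separates the linear algebra of Wirtinger derivatives from the analysis.\<close>

definition complexified :: "(complex^'n \<Rightarrow> complex) \<Rightarrow> 'n + 'n \<Rightarrow> complex" where
  "complexified L a =
    (case a of
       Inl j \<Rightarrow> (L (axis j 1) - \<i> * L (axis j \<i>)) / 2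
     | Inr j \<Rightarrow> (L (axis j 1) + \<i> * L (axis j \<i>)) / 2)"

lemma wirtinger_eq_complexified: "wirtinger a f z = complexified (frechet_derivative f (at z)) a"
  unfolding wirtinger_def complexified_def by (auto split: sum.split)

lemma wirtinger_has_derivative:
  "(f has_derivative f') (at z) \<Longrightarrow> wirtinger a f z = complexified f' a"
  unfolding wirtinger_eq_complexified using frechet_derivative_at by metis

definition std_coord :: "'n + 'n \<Rightarrow> complex^'n \<Rightarrow> complex" where
  "std_coord b w = (case b of Inl j \<Rightarrow> w $ j | Inr j \<Rightarrow> cnj (w $ j))"

lemma complexified_add: "complexified (\<lambda>v. L v + M v) a = complexified L a + complexified M a"
  unfolding complexified_def by (auto split: sum.split simp: field_simps)

lemma complexified_cmult: "complexified (\<lambda>v. k * L v) a = k * complexified L a"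
  unfolding complexified_def by (auto split: sum.split simp: field_simps)

lemma complexified_zero: "complexified (\<lambda>v. 0) a = 0"
  unfolding complexified_def by (auto split: sum.split)

lemma complexified_sum: "complexified (\<lambda>v. \<Sum>i\<in>I. L i v) a = (\<Sum>i\<in>I. complexified (L i) a)"
  by (induction I rule: infinite_finite_induct) (auto simp: complexified_zero complexified_add)

lemma sum_UNIV_Plus:
  fixes f :: "'a::finite + 'b::finite \<Rightarrow> 'c::comm_monoid_add"
  shows "(\<Sum>b\<in>UNIV. f b) = (\<Sum>j\<in>UNIV. f (Inl j)) + (\<Sum>j\<in>UNIV. f (Inr j))"
  unfolding UNIV_Plus_UNIV[symmetric] by (subst sum.Plus) auto

text \<open>The $\partial/\partial z_j$ and $\partial/\partial\bar z_j$ form a basis of the complexified tangent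
  space whose dual basis is given by the coordinates and their conjugates, so a real-linear map is
  recovered from its complexified values.\<close>

lemma complexified_expand:
  fixes L :: "complex^'n::finite \<Rightarrow> complex"
  assumes "linear L"
  shows "L w = (\<Sum>b\<in>UNIV. complexified L b * std_coord b w)"
proof -
  have "w = (\<Sum>j\<in>UNIV. Re (w $ j) *\<^sub>R axis j 1 + Im (w $ j) *\<^sub>R axis j \<i>)"
  proof (rule vec_eq_iff[THEN iffD2], rule allI)
    fix i
    have "(\<Sum>j\<in>UNIV. Re (w $ j) *\<^sub>R axis j 1 + Im (w $ j) *\<^sub>R axis j \<i>) $ i =
        (\<Sum>j\<in>UNIV. if j = i then w $ i else 0)"
      unfolding sum_component by (rule sum.cong) (auto simp: axis_def complex_eq_iff)
    then show "w $ i = (\<Sum>j\<in>UNIV. Re (w $ j) *\<^sub>R axis j 1 + Im (w $ j) *\<^sub>R axis j \<i>) $ i" by simp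
  qed
  then have "L w = L (\<Sum>j\<in>UNIV. Re (w $ j) *\<^sub>R axis j 1 + Im (w $ j) *\<^sub>R axis j \<i>)" by simp
  also have "\<dots> = (\<Sum>j\<in>UNIV. Re (w $ j) * L (axis j 1) + Im (w $ j) * L (axis j \<i>))"
    by (simp add: linear_sum[OF assms] linear_add[OF assms] linear_cmul[OF assms])
       (simp only: scaleR_conv_of_real)
  also have "\<dots> = (\<Sum>j\<in>UNIV. complexified L (Inl j) * std_coord (Inl j) w +
                          complexified L (Inr j) * std_coord (Inr j) w)"
  proof (rule sum.cong[OF refl])
    fix j
    have split: "r * u + m * v = (u - \<i> * v) / 2 * x + (u + \<i> * v) / 2 * y"
      if "x = r + \<i> * m" "y = r - \<i> * m" for r m u v x y :: complex
      unfolding that by (simp add: field_simps)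
    show "Re (w $ j) * L (axis j 1) + Im (w $ j) * L (axis j \<i>) =
        complexified L (Inl j) * std_coord (Inl j) w + complexified L (Inr j) * std_coord (Inr j) w"
      unfolding complexified_def std_coord_def sum.case
      by (rule split) (simp_all add: complex_eq_iff)
  qed
  finally show ?thesis by (simp add: sum_UNIV_Plus sum.distrib)
qed

lemma bounded_linear_std_coord: "bounded_linear (std_coord b :: complex^'n::finite \<Rightarrow> complex)"
  unfolding std_coord_def
  by (cases b) (auto intro: bounded_linear_vec_nth bounded_linear_compose[OF bounded_linear_cnj])

lemma wirtinger_cong:
  assumes "open S" "z \<in> S" "\<And>x. x \<in> S \<Longrightarrow> f x = g x"
  shows "wirtinger a f z = wirtinger a g z"
  unfolding wirtinger_eq_complexified using frechet_derivative_cong_open[OF assms] by simp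

text \<open>For an inner map that is not holomorphic the coordinates of the target and their conjugates both
  contribute. The Jacobian entries of a transition map are the first factors on the right.\<close>

lemma wirtinger_chain:
  fixes T :: "complex^'n::finite \<Rightarrow> complex^'m::finite"
  assumes T: "T differentiable (at z)" and g: "g differentiable (at (T z))"
  shows "wirtinger a (\<lambda>w. g (T w)) z =
    (\<Sum>b\<in>UNIV. wirtinger a (\<lambda>w. std_coord b (T w)) z * wirtinger b g (T z))"
proof -
  let ?DT = "frechet_derivative T (at z)" and ?Dg = "frechet_derivative g (at (T z))"
  have T': "(T has_derivative ?DT) (at z)" and g': "(g has_derivative ?Dg) (at (T z))"
    using T g frechet_derivative_works by blast+
  have "wirtinger a (\<lambda>w. g (T w)) z = complexified (\<lambda>v. ?Dg (?DT v)) a"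
    by (rule wirtinger_has_derivative[OF has_derivative_compose[OF T' g']])
  also have "(\<lambda>v. ?Dg (?DT v)) = (\<lambda>v. \<Sum>b\<in>UNIV. complexified ?Dg b * std_coord b (?DT v))"
    using complexified_expand[OF linear_frechet_derivative[OF g]] by auto
  also have "complexified \<dots> a = (\<Sum>b\<in>UNIV. complexified ?Dg b * complexified (\<lambda>v. std_coord b (?DT v)) a)"
    by (simp add: complexified_sum complexified_cmult)
  also have "\<dots> = (\<Sum>b\<in>UNIV. wirtinger a (\<lambda>w. std_coord b (T w)) z * wirtinger b g (T z))"
    using wirtinger_has_derivative[OF bounded_linear.has_derivative[OF bounded_linear_std_coord T'], of a]
    by (simp add: wirtinger_eq_complexified[of _ g] mult.commute)
  finally show ?thesis .
qed

lemma wirtinger_add: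
  assumes "f differentiable (at z)" "g differentiable (at z)"
  shows "wirtinger a (\<lambda>w. f w + g w) z = wirtinger a f z + wirtinger a g z"
  using wirtinger_has_derivative[OF has_derivative_add[OF assms[unfolded frechet_derivative_works]]]
  by (simp add: complexified_add wirtinger_eq_complexified)

lemma wirtinger_mult:
  fixes f g :: "complex^'n::finite \<Rightarrow> complex"
  assumes "f differentiable (at z)" "g differentiable (at z)"
  shows "wirtinger a (\<lambda>w. f w * g w) z = wirtinger a f z * g z + f z * wirtinger a g z"
proof -
  have "wirtinger a (\<lambda>w. f w * g w) z =
      complexified (\<lambda>v. f z * frechet_derivative g (at z) v + g z * frechet_derivative f (at z) v) a"
    using wirtinger_has_derivative[OF has_derivative_mult[OF assms[unfolded frechet_derivative_works]]]
    by (simp add: mult.commute)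
  then show ?thesis
    by (simp add: complexified_add complexified_cmult wirtinger_eq_complexified)
qed

lemma wirtinger_const: "wirtinger a (\<lambda>w. k) z = 0"
  using wirtinger_has_derivative[OF has_derivative_const] by (simp add: complexified_zero)

lemma wirtinger_cmult:
  fixes f :: "complex^'n::finite \<Rightarrow> complex"
  assumes "f differentiable (at z)"
  shows "wirtinger a (\<lambda>w. k * f w) z = k * wirtinger a f z"
  using wirtinger_mult[OF differentiable_const assms] by (simp add: wirtinger_const)

lemma wirtinger_sum:
  fixes f :: "'i \<Rightarrow> complex^'n::finite \<Rightarrow> complex"
  assumes "\<And>i. i \<in> I \<Longrightarrow> f i differentiable (at z)"
  shows "wirtinger a (\<lambda>w. \<Sum>i\<in>I. f i w) z = (\<Sum>i\<in>I. wirtinger a (f i) z)"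
  using assms
proof (induction I rule: infinite_finite_induct)
  case (insert i I)
  then have "(\<lambda>w. \<Sum>i\<in>I. f i w) differentiable (at z)" by (intro differentiable_sum) auto
  with insert show ?case by (simp add: wirtinger_add)
qed (auto simp: wirtinger_const)

lemma wirtinger_cnj:
  fixes f :: "complex^'n::finite \<Rightarrow> complex"
  assumes "f differentiable (at z)"
  shows "wirtinger (Inl j) (\<lambda>w. cnj (f w)) z = cnj (wirtinger (Inr j) f z)"
  by (simp add: wirtinger_def frechet_derivative_bounded_linear[OF bounded_linear_cnj assms])

lemma smooth_on_wirtinger:
  fixes f :: "complex^'n::finite \<Rightarrow> complex"
  assumes S: "open S" and f: "smooth_on S f"
  shows "smooth_on S (wirtinger a f)"
proof -
  have lin: "bounded_linear (\<lambda>x::complex. k * x)" for k by (rule bounded_linear_mult_right)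
  have "smooth_on S (\<lambda>z. k * frechet_derivative f (at z) u + k' * frechet_derivative f (at z) v)" for k k' u v
    by (intro smooth_on_add smooth_on_bounded_linear[OF lin] S smooth_on_deriv f)
  from this[of "1/2" _ "- \<i>/2"] this[of "1/2" _ "\<i>/2"] show ?thesis
    unfolding wirtinger_def by (cases a) (simp_all add: diff_divide_distrib add_divide_distrib)
qed

text \<open>Each Wirtinger derivative is a fixed complex combination of two directional derivatives, so this is
  the symmetry of real second derivatives.\<close>

lemma wirtinger_commute:
  fixes f :: "complex^'n::finite \<Rightarrow> complex"
  assumes S: "open S" and f: "smooth_on S f" and z: "z \<in> S"
  shows "wirtinger a (wirtinger b f) z = wirtinger b (wirtinger a f) z"
proof -
  define D where "D u v = frechet_derivative (\<lambda>x. frechet_derivative f (at x) u) (at z) v" for u v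
  have sym: "D u v = D v u" for u v
    unfolding D_def by (rule second_derivative_symmetric[OF S f z])
  have der: "((\<lambda>x. frechet_derivative f (at x) u) has_derivative D u) (at z)" for u
    using smooth_on_has_derivative[OF smooth_on_deriv[OF f] z] unfolding D_def by blast
  have outer: "wirtinger a (wirtinger b f) z = complexified (\<lambda>v. complexified (\<lambda>u. D u v) b) a" for a b
  proof (rule wirtinger_has_derivative)
    show "(wirtinger b f has_derivative (\<lambda>v. complexified (\<lambda>u. D u v) b)) (at z)"
      unfolding wirtinger_def complexified_def divide_complex_def
      by (cases b) (auto intro!: derivative_eq_intros der)
  qed
  have normal_form: "\<exists>u v k. \<forall>L. complexified L a = (L u + k * L v) / 2" for a :: "'n + 'n"
  proof (cases a)
    case (Inl j)
    then have "\<forall>L. complexified L a = (L (axis j 1) + (- \<i>) * L (axis j \<i>)) / 2"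
      by (simp add: complexified_def)
    then show ?thesis by blast
  next
    case (Inr j)
    then have "\<forall>L. complexified L a = (L (axis j 1) + \<i> * L (axis j \<i>)) / 2"
      by (simp add: complexified_def)
    then show ?thesis by blast
  qed
  obtain u v k where a: "\<And>L. complexified L a = (L u + k * L v) / 2" using normal_form[of a] by blast
  obtain u' v' k' where b: "\<And>L. complexified L b = (L u' + k' * L v') / 2" using normal_form[of b] by blast
  show ?thesis
    unfolding outer a b sym[of u' u] sym[of u' v] sym[of v' u] sym[of v' v] by (simp add: algebra_simps add_divide_distrib)
qed


section \<open>Derivatives in charts and transition maps\<close>

lemma coord_eq_std_coord: "coord d b p = std_coord b (snd d p)"
  by (simp add: coord_def std_coord_def)

context
  fixes X :: "'a topology" and A :: "('a, 'n::finite) chart set"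
  assumes M: "complex_manifold X A"
begin

lemma chart_image_open: "c \<in> A \<Longrightarrow> open (snd c ` fst c)"
  using M unfolding complex_manifold_def is_chart_def by blast

lemma chart_inj: "c \<in> A \<Longrightarrow> inj_on (snd c) (fst c)"
  using M unfolding complex_manifold_def is_chart_def
  by (metis homeomorphic_imp_injective_map openin_subset topspace_subtopology_subset)

lemma overlap_image_open:
  assumes "c \<in> A" "d \<in> A"
  shows "open (snd c ` (fst c \<inter> fst d))"
proof -
  have "openin X (fst d)" and hom: "homeomorphic_map (subtopology X (fst c)) (top_of_set (snd c ` fst c)) (snd c)"
    using M assms unfolding complex_manifold_def is_chart_def by blast+
  then have "openin (subtopology X (fst c)) (fst c \<inter> fst d)"
    unfolding openin_subtopology by blast
  with homeomorphic_imp_open_map[OF hom] have "openin (top_of_set (snd c ` fst c)) (snd c ` (fst c \<inter> fst d))"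
    unfolding open_map_def by blast
  then show ?thesis using chart_image_open[OF assms(1)] openin_open_trans by blast
qed

lemma transition_smooth:
  "c \<in> A \<Longrightarrow> d \<in> A \<Longrightarrow> smooth_on (snd c ` (fst c \<inter> fst d)) (snd d \<circ> inv_into (fst c) (snd c))"
  using M unfolding complex_manifold_def holomorphic_map_on_def by blast

lemma chart_inv: "c \<in> A \<Longrightarrow> p \<in> fst c \<Longrightarrow> inv_into (fst c) (snd c) (snd c p) = p"
  by (rule inv_into_f_f[OF chart_inj])

lemma smooth_in_chart_differentiable:
  assumes "smooth_in_chart c f" "p \<in> fst c"
  shows "(f \<circ> inv_into (fst c) (snd c)) differentiable (at (snd c p))"
  using assms smooth_on_differentiable unfolding smooth_in_chart_def by blast

lemma smooth_in_chart_add: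
  "c \<in> A \<Longrightarrow> smooth_in_chart c f \<Longrightarrow> smooth_in_chart c g \<Longrightarrow> smooth_in_chart c (\<lambda>p. f p + g p)"
  unfolding smooth_in_chart_def o_def by (intro smooth_on_add chart_image_open)

lemma smooth_in_chart_cmult:
  fixes f :: "'a \<Rightarrow> complex"
  shows "c \<in> A \<Longrightarrow> smooth_in_chart c f \<Longrightarrow> smooth_in_chart c (\<lambda>p. k * f p)"
  unfolding smooth_in_chart_def o_def
  by (intro smooth_on_bounded_linear[OF bounded_linear_mult_right] chart_image_open)

lemma smooth_in_chart_zero: "c \<in> A \<Longrightarrow> smooth_in_chart c (\<lambda>p. 0)"
  unfolding smooth_in_chart_def o_def by (intro smooth_on_zero chart_image_open)

lemma smooth_in_chart_sum:
  "c \<in> A \<Longrightarrow> (\<And>i. i \<in> I \<Longrightarrow> smooth_in_chart c (f i)) \<Longrightarrow> smooth_in_chart c (\<lambda>p. \<Sum>i\<in>I. f i p)"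
  unfolding smooth_in_chart_def o_def by (intro smooth_on_sum chart_image_open)

lemma smooth_in_chart_cong:
  assumes "c \<in> A" "\<And>p. p \<in> fst c \<Longrightarrow> f p = g p" "smooth_in_chart c f"
  shows "smooth_in_chart c g"
  using smooth_on_cong[OF chart_image_open[OF assms(1)] _ assms(3)[unfolded smooth_in_chart_def]]
    assms(2) unfolding smooth_in_chart_def by (auto simp: inv_into_into)

lemma smooth_in_chart_chart_deriv:
  assumes c: "c \<in> A" and f: "smooth_in_chart c f"
  shows "smooth_in_chart c (chart_deriv c a f)"
  unfolding smooth_in_chart_def
  by (rule smooth_on_cong[OF chart_image_open[OF c] _
        smooth_on_wirtinger[OF chart_image_open[OF c] f[unfolded smooth_in_chart_def]]])
     (auto simp: chart_deriv_def chart_inv[OF c])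

text \<open>Agreement on the overlap with another chart is enough; the case \<open>d = c\<close> is agreement on the whole
  domain. This is how a transformation law, which holds on overlaps only, is differentiated.\<close>

lemma chart_deriv_cong:
  assumes "c \<in> A" "d \<in> A" "p \<in> fst c \<inter> fst d" "\<And>q. q \<in> fst c \<inter> fst d \<Longrightarrow> f q = g q"
  shows "chart_deriv c a f p = chart_deriv c a g p"
  unfolding chart_deriv_def
  by (rule wirtinger_cong[OF overlap_image_open[OF assms(1,2)]])
     (use assms chart_inv in auto)

lemma chart_deriv_add:
  assumes "smooth_in_chart c f" "smooth_in_chart c g" "p \<in> fst c"
  shows "chart_deriv c a (\<lambda>q. f q + g q) p = chart_deriv c a f p + chart_deriv c a g p"
  using wirtinger_add[OF assms(1,2)[THEN smooth_in_chart_differentiable, OF assms(3)]]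
  by (simp add: chart_deriv_def o_def)

lemma chart_deriv_cmult:
  assumes "smooth_in_chart c f" "p \<in> fst c"
  shows "chart_deriv c a (\<lambda>q. k * f q) p = k * chart_deriv c a f p"
  using wirtinger_cmult[OF smooth_in_chart_differentiable[OF assms]]
  by (simp add: chart_deriv_def o_def)

lemma chart_deriv_sum:
  assumes "\<And>i. i \<in> I \<Longrightarrow> smooth_in_chart c (f i)" "p \<in> fst c"
  shows "chart_deriv c a (\<lambda>q. \<Sum>i\<in>I. f i q) p = (\<Sum>i\<in>I. chart_deriv c a (f i) p)"
  using wirtinger_sum[of I "\<lambda>i. f i \<circ> inv_into (fst c) (snd c)" "snd c p" a]
    smooth_in_chart_differentiable[OF assms(1) assms(2)]
  by (simp add: chart_deriv_def o_def)

lemma chart_deriv_zero: "chart_deriv c a (\<lambda>q. 0) p = 0"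
  by (simp add: chart_deriv_def o_def wirtinger_const)

lemma chart_deriv_commute:
  assumes c: "c \<in> A" and f: "smooth_in_chart c f" and p: "p \<in> fst c"
  shows "chart_deriv c a (chart_deriv c b f) p = chart_deriv c b (chart_deriv c a f) p"
proof -
  let ?F = "f \<circ> inv_into (fst c) (snd c)" and ?z = "snd c p"
  have z: "?z \<in> snd c ` fst c" using p by blast
  have "chart_deriv c a (chart_deriv c b f) p = wirtinger a (wirtinger b ?F) ?z" for a b
    unfolding chart_deriv_def[of c a]
    by (rule wirtinger_cong[OF chart_image_open[OF c] z]) (auto simp: chart_deriv_def chart_inv[OF c])
  then show ?thesis
    using wirtinger_commute[OF chart_image_open[OF c] f[unfolded smooth_in_chart_def] z] by metis
qed

lemma transition_coord_smooth:
  assumes "c \<in> A" "d \<in> A"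
  shows "smooth_on (snd c ` (fst c \<inter> fst d)) (coord d b \<circ> inv_into (fst c) (snd c))"
  using smooth_on_bounded_linear[OF bounded_linear_std_coord overlap_image_open[OF assms] transition_smooth[OF assms]]
  by (simp add: o_def coord_eq_std_coord)

lemma other_chart_representation:
  assumes "c \<in> A" "d \<in> A" "w \<in> snd c ` (fst c \<inter> fst d)"
  shows "(f \<circ> inv_into (fst c) (snd c)) w =
         (f \<circ> inv_into (fst d) (snd d)) ((snd d \<circ> inv_into (fst c) (snd c)) w)"
  using assms chart_inv by auto

lemma smooth_in_other_chart_differentiable:
  assumes c: "c \<in> A" and d: "d \<in> A" and p: "p \<in> fst c \<inter> fst d" and f: "smooth_in_chart d f"
  shows "(f \<circ> inv_into (fst c) (snd c)) differentiable (at (snd c p))"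
proof -
  let ?U = "snd c ` (fst c \<inter> fst d)" and ?T = "snd d \<circ> inv_into (fst c) (snd c)"
  have z: "snd c p \<in> ?U" using p by blast
  have "((f \<circ> inv_into (fst d) (snd d)) \<circ> ?T) differentiable (at (snd c p))"
    using smooth_on_differentiable[OF transition_smooth[OF c d] z] smooth_in_chart_differentiable[OF f] p
    by (intro differentiable_chain_at) (auto simp: chart_inv[OF c])
  then obtain D where "(((f \<circ> inv_into (fst d) (snd d)) \<circ> ?T) has_derivative D) (at (snd c p))"
    unfolding differentiable_def by blast
  then have "((f \<circ> inv_into (fst c) (snd c)) has_derivative D) (at (snd c p))"
    by (rule has_derivative_transform_within_open[OF _ overlap_image_open[OF c d] z]) (metis o_apply other_chart_representation[OF c d])
  then show ?thesis unfolding differentiable_def by blast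
qed

text \<open>A coordinate vector field of \<open>c\<close> is expressed in those of \<open>d\<close> by the Jacobian of the transition
  map.\<close>

lemma chart_deriv_transform:
  assumes c: "c \<in> A" and d: "d \<in> A" and p: "p \<in> fst c \<inter> fst d" and f: "smooth_in_chart d f"
  shows "chart_deriv c a f p = (\<Sum>b\<in>UNIV. jac c d p b a * chart_deriv d b f p)"
proof -
  let ?U = "snd c ` (fst c \<inter> fst d)" and ?T = "snd d \<circ> inv_into (fst c) (snd c)" and ?z = "snd c p"
  have z: "?z \<in> ?U" using p by blast
  have Tz: "?T ?z = snd d p" using p chart_inv[OF c] by simp
  have "chart_deriv c a f p = wirtinger a (\<lambda>w. (f \<circ> inv_into (fst d) (snd d)) (?T w)) ?z"
    unfolding chart_deriv_def
    by (rule wirtinger_cong[OF overlap_image_open[OF c d] z other_chart_representation[OF c d]])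
  also have "\<dots> = (\<Sum>b\<in>UNIV. wirtinger a (\<lambda>w. std_coord b (?T w)) ?z *
      wirtinger b (f \<circ> inv_into (fst d) (snd d)) (?T ?z))"
    using smooth_on_differentiable[OF transition_smooth[OF c d] z] smooth_in_chart_differentiable[OF f, of p] p
    by (intro wirtinger_chain) (auto simp: chart_inv[OF c] simp del: o_apply simp: Tz)
  finally show ?thesis
    unfolding Tz by (simp add: jac_def chart_deriv_def o_def coord_eq_std_coord)
qed

lemma chart_deriv_jac:
  assumes c: "c \<in> A" and d: "d \<in> A" and p: "p \<in> fst c \<inter> fst d"
  shows "chart_deriv c a (\<lambda>q. jac c d q b e) p =
         wirtinger a (wirtinger e (coord d b \<circ> inv_into (fst c) (snd c))) (snd c p)"
  unfolding chart_deriv_def[of c a]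
  by (rule wirtinger_cong[OF overlap_image_open[OF c d]])
     (use p in \<open>auto simp: jac_def chart_deriv_def chart_inv[OF c]\<close>)

text \<open>The entries of the Jacobian are first derivatives of the transition map, so this is again the
  symmetry of second derivatives. It cancels the terms that prevent the derivative of a one-form
  from transforming like a tensor before it is antisymmetrized.\<close>

lemma chart_deriv_jac_symmetric:
  assumes c: "c \<in> A" and d: "d \<in> A" and p: "p \<in> fst c \<inter> fst d"
  shows "chart_deriv c a (\<lambda>q. jac c d q b e) p = chart_deriv c e (\<lambda>q. jac c d q b a) p"
  unfolding chart_deriv_jac[OF assms]
  by (rule wirtinger_commute[OF overlap_image_open[OF c d] transition_coord_smooth[OF c d]]) (use p in blast)

text \<open>The product rule for components \<open>g\<close> obtained by a Jacobian from components \<open>f\<close> in another chart.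
  The \<open>f b\<close> are differentiated in the chart \<open>c\<close>, although they are only known to be smooth in \<open>d\<close>.\<close>

lemma chart_deriv_pullback:
  assumes c: "c \<in> A" and d: "d \<in> A" and p: "p \<in> fst c \<inter> fst d"
    and f: "\<And>b. smooth_in_chart d (f b)"
    and g: "\<And>q. q \<in> fst c \<inter> fst d \<Longrightarrow> g q = (\<Sum>b\<in>UNIV. jac c d q b e * f b q)"
  shows "chart_deriv c a g p =
    (\<Sum>b\<in>UNIV. chart_deriv c a (\<lambda>q. jac c d q b e) p * f b p + jac c d p b e * chart_deriv c a (f b) p)"
proof -
  let ?U = "snd c ` (fst c \<inter> fst d)" and ?i = "inv_into (fst c) (snd c)" and ?z = "snd c p"
  let ?W = "\<lambda>b. wirtinger e (coord d b \<circ> ?i)"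
  have z: "?z \<in> ?U" using p by blast
  have W: "?W b differentiable (at ?z)" for b
    by (rule smooth_on_differentiable[OF smooth_on_wirtinger[OF overlap_image_open[OF c d] transition_coord_smooth[OF c d]] z])
  have fd: "(f b \<circ> ?i) differentiable (at ?z)" for b
    by (rule smooth_in_other_chart_differentiable[OF c d p f])
  have "chart_deriv c a g p = wirtinger a (\<lambda>w. \<Sum>b\<in>UNIV. ?W b w * (f b \<circ> ?i) w) ?z"
    unfolding chart_deriv_def
    by (rule wirtinger_cong[OF overlap_image_open[OF c d] z])
       (auto simp: g jac_def chart_deriv_def chart_inv[OF c])
  also have "\<dots> = (\<Sum>b\<in>UNIV. wirtinger a (\<lambda>w. ?W b w * (f b \<circ> ?i) w) ?z)"
    by (rule wirtinger_sum) (intro differentiable_mult W fd)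
  also have "\<dots> = (\<Sum>b\<in>UNIV. wirtinger a (?W b) ?z * (f b \<circ> ?i) ?z + ?W b ?z * wirtinger a (f b \<circ> ?i) ?z)"
    by (simp only: wirtinger_mult[OF W fd])
  also have "\<dots> = (\<Sum>b\<in>UNIV. chart_deriv c a (\<lambda>q. jac c d q b e) p * f b p + jac c d p b e * chart_deriv c a (f b) p)"
    using p by (simp add: chart_deriv_jac[OF c d p] chart_inv[OF c]) (simp add: jac_def chart_deriv_def)
  finally show ?thesis .
qed

text \<open>Transition maps are holomorphic, so their Jacobian is block diagonal for the splitting of the
  complexified tangent space into types $(1,0)$ and $(0,1)$. Every statement about bidegrees rests on
  this.\<close>

lemma jac_eq_0:
  assumes c: "c \<in> A" and d: "d \<in> A" and p: "p \<in> fst c \<inter> fst d" and types: "isl a \<noteq> isl b"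
  shows "jac c d p b a = 0"
proof -
  let ?T = "snd d \<circ> inv_into (fst c) (snd c)" and ?z = "snd c p"
  have z: "?z \<in> snd c ` (fst c \<inter> fst d)" using p by blast
  have hol: "wirtinger (Inr j) (\<lambda>w. ?T w $ i) ?z = 0" for i j
    using M c d z unfolding complex_manifold_def holomorphic_map_on_def by blast
  have diff: "(\<lambda>w. ?T w $ i) differentiable (at ?z)" for i
    using smooth_on_differentiable[OF transition_coord_smooth[OF c d] z, of "Inl i"]
    by (simp add: o_def coord_def)
  show ?thesis
  proof (cases b)
    case (Inl i)
    with types obtain j where "a = Inr j" by (cases a) auto
    with Inl hol[of j i] show ?thesis by (simp add: jac_def chart_deriv_def o_def coord_def)
  next
    case (Inr i)
    with types obtain j where "a = Inl j" by (cases a) auto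
    with Inr hol[of j i] wirtinger_cnj[OF diff[of i], of j] show ?thesis
      by (simp add: jac_def chart_deriv_def o_def coord_def)
  qed
qed

end


section \<open>Index lists, bidegrees and the differential operators\<close>

text \<open>The operation on index lists by which \<open>d_part\<close> omits an argument.\<close>

definition drop_nth :: "nat \<Rightarrow> 'b list \<Rightarrow> 'b list" where
  "drop_nth i l = take i l @ drop (Suc i) l"

lemma length_drop_nth: "i < length l \<Longrightarrow> length (drop_nth i l) = length l - 1"
  by (simp add: drop_nth_def)

lemma nth_drop_nth:
  "i < length l \<Longrightarrow> j < length l - 1 \<Longrightarrow> drop_nth i l ! j = (if j < i then l ! j else l ! Suc j)"
  by (auto simp: drop_nth_def nth_append min_def)

text \<open>Omitting two positions in either order gives the same list, but omitting the smaller one first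
  moves the larger one down by one. This shift is the source of the sign in
  $\partial\bar\partial = -\bar\partial\partial$.\<close>

lemma drop_nth_drop_nth:
  assumes "j < i" "i < length l"
  shows "drop_nth (i - 1) (drop_nth j l) = drop_nth j (drop_nth i l)"
  using assms by (intro nth_equalityI) (auto simp: length_drop_nth nth_drop_nth)

lemmas d_part_alt = d_part_def[folded drop_nth_def]

text \<open>The differential operators act chart by chart, and the identities between them are identities of
  smooth components. Stated in this generality they cover the potentials \<open>ln (h c p)\<close> of the
  curvature, which do not glue to a form.\<close>

definition chartwise_smooth :: "('a, 'n::finite) chart set \<Rightarrow> ('a, 'n) form \<Rightarrow> bool" where
  "chartwise_smooth A \<omega> \<longleftrightarrow> (\<forall>c\<in>A. \<forall>l. smooth_in_chart c (\<lambda>p. \<omega> c p l))"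

lemma formsI:
  assumes "\<And>c p l. \<not> (c \<in> A \<and> p \<in> fst c) \<Longrightarrow> \<omega> c p l = 0"
    and "\<And>c p l i j. i < j \<Longrightarrow> j < length l \<Longrightarrow> \<omega> c p (l[i := l ! j, j := l ! i]) = - \<omega> c p l"
    and "\<And>c l. c \<in> A \<Longrightarrow> smooth_in_chart c (\<lambda>p. \<omega> c p l)"
    and "\<And>c d p l. c \<in> A \<Longrightarrow> d \<in> A \<Longrightarrow> p \<in> fst c \<inter> fst d \<Longrightarrow>
      \<omega> c p l = (\<Sum>m | length m = length l. (\<Prod>i<length l. jac c d p (m ! i) (l ! i)) * \<omega> d p m)"
  shows "\<omega> \<in> forms A"
  unfolding forms_def using assms by blast

lemma forms_zero: "\<omega> \<in> forms A \<Longrightarrow> \<not> (c \<in> A \<and> p \<in> fst c) \<Longrightarrow> \<omega> c p l = 0"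
  unfolding forms_def by blast

lemma forms_antisymmetric:
  "\<omega> \<in> forms A \<Longrightarrow> i < j \<Longrightarrow> j < length l \<Longrightarrow> \<omega> c p (l[i := l ! j, j := l ! i]) = - \<omega> c p l"
  unfolding forms_def by blast

lemma forms_transform:
  "\<omega> \<in> forms A \<Longrightarrow> c \<in> A \<Longrightarrow> d \<in> A \<Longrightarrow> p \<in> fst c \<inter> fst d \<Longrightarrow>
    \<omega> c p l = (\<Sum>m | length m = length l. (\<Prod>i<length l. jac c d p (m ! i) (l ! i)) * \<omega> d p m)"
  unfolding forms_def by blast

lemma forms_chartwise_smooth: "\<omega> \<in> forms A \<Longrightarrow> chartwise_smooth A \<omega>"
  unfolding forms_def chartwise_smooth_def by blast

definition scale :: "complex \<Rightarrow> ('a, 'n::finite) form \<Rightarrow> ('a, 'n) form" where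
  "scale k \<omega> = (\<lambda>c p l. k * \<omega> c p l)"

lemma minus_eq_scale: "- \<omega> = scale (-1) \<omega>"
  by (auto simp: scale_def fun_eq_iff)

lemma ext_d_eq: "ext_d A \<omega> = del A \<omega> + delbar A \<omega>"
proof -
  have "(\<Sum>i | i < length l. f i) = (\<Sum>i | i < length l \<and> isl (l ! i). f i) + (\<Sum>i | i < length l \<and> \<not> isl (l ! i). f i)"
    for f :: "nat \<Rightarrow> complex" and l :: "('n + 'n) list"
    by (subst sum.union_disjoint[symmetric]) (auto intro!: sum.cong)
  then show ?thesis
    unfolding ext_d_def del_def delbar_def d_part_def by (auto simp: fun_eq_iff)
qed

definition bidegree :: "nat \<Rightarrow> nat \<Rightarrow> ('n + 'n) list \<Rightarrow> bool" where
  "bidegree p q l \<longleftrightarrow> length (filter isl l) = p \<and> length (filter (\<lambda>a. \<not> isl a) l) = q"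

lemma bidegree_length: "bidegree p q l \<Longrightarrow> length l = p + q"
  using sum_length_filter_compl[of isl l] by (simp add: bidegree_def)

text \<open>Omitting an argument of type $(1,0)$ or $(0,1)$ lowers the corresponding degree by one, so the
  operators \<open>del\<close> and \<open>delbar\<close> are homogeneous of bidegree $(1,0)$ and $(0,1)$.\<close>

lemma bidegree_drop_nth:
  fixes l :: "('n + 'n) list"
  assumes "i < length l"
  shows "isl (l ! i) \<Longrightarrow> bidegree (Suc p) q l \<longleftrightarrow> bidegree p q (drop_nth i l)"
    and "\<not> isl (l ! i) \<Longrightarrow> bidegree p (Suc q) l \<longleftrightarrow> bidegree p q (drop_nth i l)"
proof -
  have "length (filter P l) = length (filter P (drop_nth i l)) + (if P (l ! i) then 1 else 0)" for P :: "'n + 'n \<Rightarrow> bool"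
    using arg_cong[OF id_take_nth_drop[OF assms], of "\<lambda>l. length (filter P l)"]
    unfolding drop_nth_def filter_append by simp
  from this[of isl] this[of "\<lambda>a. \<not> isl a"]
  show "isl (l ! i) \<Longrightarrow> bidegree (Suc p) q l \<longleftrightarrow> bidegree p q (drop_nth i l)"
    and "\<not> isl (l ! i) \<Longrightarrow> bidegree p (Suc q) l \<longleftrightarrow> bidegree p q (drop_nth i l)"
    by (auto simp: bidegree_def)
qed

lemma bidegree_cong:
  fixes l m :: "('n + 'n) list"
  assumes "length m = length l" "\<And>i. i < length l \<Longrightarrow> isl (m ! i) = isl (l ! i)"
  shows "bidegree p q m = bidegree p q l"
proof -
  have "length (filter P m) = length (filter P l)" if "\<And>i. i < length l \<Longrightarrow> P (m ! i) = P (l ! i)"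
    for P :: "'n + 'n \<Rightarrow> bool"
    using assms(1) that by (auto simp: length_filter_conv_card intro!: arg_cong[of _ _ card])
  then show ?thesis unfolding bidegree_def using assms(2) by auto
qed

lemma bidegree_swap:
  assumes "i < length l" "j < length l"
  shows "bidegree p q (l[i := l ! j, j := l ! i]) = bidegree p q l"
proof -
  have "mset (filter P (l[i := l ! j, j := l ! i])) = mset (filter P l)" for P
    unfolding mset_filter using mset_swap[OF assms(2,1)] by simp
  then show ?thesis unfolding bidegree_def by (metis size_mset)
qed

definition bidegree_part :: "nat \<Rightarrow> nat \<Rightarrow> ('a, 'n::finite) form \<Rightarrow> ('a, 'n) form" where
  "bidegree_part p q \<omega> = (\<lambda>c x l. if bidegree p q l then \<omega> c x l else 0)"

lemma forms_pq_iff: "\<omega> \<in> forms_pq A p q \<longleftrightarrow> \<omega> \<in> forms A \<and> bidegree_part p q \<omega> = \<omega>"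
  unfolding forms_pq_def bidegree_part_def bidegree_def by (auto simp: fun_eq_iff)

lemma bidegree_part_add: "bidegree_part p q (\<omega> + \<eta>) = bidegree_part p q \<omega> + bidegree_part p q \<eta>"
  unfolding bidegree_part_def by (auto simp: fun_eq_iff)

lemma bidegree_part_diff: "bidegree_part p q (\<omega> - \<eta>) = bidegree_part p q \<omega> - bidegree_part p q \<eta>"
  unfolding bidegree_part_def by (auto simp: fun_eq_iff)

lemma sum_lists_1: "(\<Sum>m | length m = Suc 0. g m) = (\<Sum>b\<in>UNIV. g [b])"
  by (rule sum.reindex_bij_witness[of _ "\<lambda>b. [b]" hd]) (auto simp: length_Suc_conv)

lemma sum_lists_2: "(\<Sum>m | length m = Suc (Suc 0). g m) = (\<Sum>b\<in>UNIV. \<Sum>e\<in>UNIV. g [b, e])"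
  unfolding sum.cartesian_product
  by (rule sum.reindex_bij_witness[of _ "\<lambda>(b, e). [b, e]" "\<lambda>m. (hd m, hd (tl m))"])
     (auto simp: length_Suc_conv)

context
  fixes X :: "'a topology" and A :: "('a, 'n::finite) chart set"
  assumes M: "complex_manifold X A"
begin

lemma smooth_in_chart_d_part:
  assumes "chartwise_smooth A \<omega>" "c \<in> A"
  shows "smooth_in_chart c (\<lambda>p. d_part P A \<omega> c p l)"
proof (rule smooth_in_chart_cong[OF M \<open>c \<in> A\<close>])
  show "smooth_in_chart c (\<lambda>p. \<Sum>i | i < length l \<and> P (l ! i).
      (-1) ^ i * chart_deriv c (l ! i) (\<lambda>q. \<omega> c q (drop_nth i l)) p)"
    using assms unfolding chartwise_smooth_def
    by (intro smooth_in_chart_sum[OF M] smooth_in_chart_cmult[OF M] smooth_in_chart_chart_deriv[OF M]) auto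
qed (use assms(2) in \<open>simp add: d_part_alt\<close>)

lemma chartwise_smooth_d_part: "chartwise_smooth A \<omega> \<Longrightarrow> chartwise_smooth A (d_part P A \<omega>)"
  using smooth_in_chart_d_part unfolding chartwise_smooth_def by blast

lemma chartwise_smooth_add:
  "chartwise_smooth A \<omega> \<Longrightarrow> chartwise_smooth A \<eta> \<Longrightarrow> chartwise_smooth A (\<omega> + \<eta>)"
  unfolding chartwise_smooth_def by (auto intro!: smooth_in_chart_add[OF M])

lemma chartwise_smooth_scale: "chartwise_smooth A \<omega> \<Longrightarrow> chartwise_smooth A (scale k \<omega>)"
  unfolding chartwise_smooth_def scale_def by (auto intro!: smooth_in_chart_cmult[OF M])

lemma d_part_add:
  assumes "chartwise_smooth A \<omega>" "chartwise_smooth A \<eta>"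
  shows "d_part P A (\<omega> + \<eta>) = d_part P A \<omega> + d_part P A \<eta>"
proof (intro ext)
  fix c p l
  have "chart_deriv c a (\<lambda>q. \<omega> c q m + \<eta> c q m) p =
      chart_deriv c a (\<lambda>q. \<omega> c q m) p + chart_deriv c a (\<lambda>q. \<eta> c q m) p" if "c \<in> A" "p \<in> fst c" for a m
    using assms that unfolding chartwise_smooth_def by (intro chart_deriv_add[OF M]) auto
  then show "d_part P A (\<omega> + \<eta>) c p l = (d_part P A \<omega> + d_part P A \<eta>) c p l"
    by (simp add: d_part_alt distrib_left sum.distrib)
qed

lemma d_part_scale:
  assumes "chartwise_smooth A \<omega>"
  shows "d_part P A (scale k \<omega>) = scale k (d_part P A \<omega>)"
proof (intro ext)
  fix c p l
  have "chart_deriv c a (\<lambda>q. k * \<omega> c q m) p = k * chart_deriv c a (\<lambda>q. \<omega> c q m) p"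
    if "c \<in> A" "p \<in> fst c" for a m
    using assms that unfolding chartwise_smooth_def by (intro chart_deriv_cmult[OF M]) auto
  then show "d_part P A (scale k \<omega>) c p l = scale k (d_part P A \<omega>) c p l"
    by (simp add: d_part_alt scale_def sum_distrib_left mult.left_commute)
qed

lemma d_part_d_part:
  assumes \<omega>: "chartwise_smooth A \<omega>" and c: "c \<in> A" and p: "p \<in> fst c"
  shows "d_part P A (d_part Q A \<omega>) c p l =
    (\<Sum>(i, j) | i < length l \<and> P (l ! i) \<and> j < length l - 1 \<and> Q (drop_nth i l ! j).
      (-1) ^ (i + j) *
      chart_deriv c (l ! i) (chart_deriv c (drop_nth i l ! j) (\<lambda>q. \<omega> c q (drop_nth j (drop_nth i l)))) p)"
proof -
  let ?J = "\<lambda>i. {j. j < length l - 1 \<and> Q (drop_nth i l ! j)}"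
  let ?D = "\<lambda>i j. chart_deriv c (drop_nth i l ! j) (\<lambda>q. \<omega> c q (drop_nth j (drop_nth i l)))"
  have smooth: "smooth_in_chart c (?D i j)" for i j
    using \<omega> c unfolding chartwise_smooth_def by (intro smooth_in_chart_chart_deriv[OF M]) auto
  have "chart_deriv c a (\<lambda>q. d_part Q A \<omega> c q (drop_nth i l)) p = (\<Sum>j\<in>?J i. (-1) ^ j * chart_deriv c a (?D i j) p)"
    if "i < length l" for a i
  proof -
    have "chart_deriv c a (\<lambda>q. d_part Q A \<omega> c q (drop_nth i l)) p =
        chart_deriv c a (\<lambda>q. \<Sum>j\<in>?J i. (-1) ^ j * ?D i j q) p"
      by (rule chart_deriv_cong[OF M c c]) (use p c that in \<open>auto simp: d_part_alt length_drop_nth\<close>)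
    also have "\<dots> = (\<Sum>j\<in>?J i. chart_deriv c a (\<lambda>q. (-1) ^ j * ?D i j q) p)"
      by (intro chart_deriv_sum[OF M] smooth_in_chart_cmult[OF M] smooth c p)
    also have "\<dots> = (\<Sum>j\<in>?J i. (-1) ^ j * chart_deriv c a (?D i j) p)"
      by (simp add: chart_deriv_cmult[OF M smooth p])
    finally show ?thesis .
  qed
  then have "d_part P A (d_part Q A \<omega>) c p l =
      (\<Sum>i | i < length l \<and> P (l ! i). \<Sum>j\<in>?J i. (-1) ^ (i + j) * chart_deriv c (l ! i) (?D i j) p)"
    using c p unfolding d_part_alt[of P]
    by (auto simp: sum_distrib_left power_add mult.assoc intro!: sum.cong)
  also have "\<dots> = (\<Sum>(i, j)\<in>(SIGMA i:{i. i < length l \<and> P (l ! i)}. ?J i).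
      (-1) ^ (i + j) * chart_deriv c (l ! i) (?D i j) p)"
    by (rule sum.Sigma) auto
  also have "(SIGMA i:{i. i < length l \<and> P (l ! i)}. ?J i) =
      {(i, j). i < length l \<and> P (l ! i) \<and> j < length l - 1 \<and> Q (drop_nth i l ! j)}" by auto
  finally show ?thesis .
qed

text \<open>Both sides are sums over ordered pairs of distinct positions. Exchanging the two positions turns one
  sum into the other: the second derivatives agree by symmetry, and the exponents of \<open>-1\<close> differ by
  one because the later of the two positions is shifted when the earlier one is omitted first. With
  \<open>P = Q\<close> it gives $\partial^2 = \bar\partial^2 = 0$.\<close>

lemma d_part_anticommute:
  assumes \<omega>: "chartwise_smooth A \<omega>"
  shows "d_part P A (d_part Q A \<omega>) = - d_part Q A (d_part P A \<omega>)"
proof (intro ext)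
  fix c p l
  show "d_part P A (d_part Q A \<omega>) c p l = (- d_part Q A (d_part P A \<omega>)) c p l"
  proof (cases "c \<in> A \<and> p \<in> fst c")
    case True
    then have c: "c \<in> A" and p: "p \<in> fst c" by auto
    \<comment> \<open>a pair \<open>(i, j)\<close> names the position \<open>i\<close> of \<open>l\<close> and the position \<open>j\<close> of \<open>l\<close> without its \<open>i\<close>-th entry; \<open>swap\<close> names the same two entries in the opposite order\<close>
    define swap :: "nat \<times> nat \<Rightarrow> nat \<times> nat" where
      "swap = (\<lambda>(i, j). if j < i then (j, i - 1) else (Suc j, i))"
    define S where "S P Q = {(i, j). i < length l \<and> P (l ! i) \<and> j < length l - 1 \<and> Q (drop_nth i l ! j)}"
      for P Q :: "'n + 'n \<Rightarrow> bool"
    define t where "t i j = (-1) ^ (i + j) *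
      chart_deriv c (l ! i) (chart_deriv c (drop_nth i l ! j) (\<lambda>q. \<omega> c q (drop_nth j (drop_nth i l)))) p"
      for i j
    have swap_S: "swap x \<in> S Q P" if "x \<in> S P Q" for x and P Q :: "'n + 'n \<Rightarrow> bool"
      using that unfolding S_def swap_def by (auto simp: nth_drop_nth split: if_splits)
    have swap_swap: "swap (swap x) = x" for x
      unfolding swap_def by (auto split: prod.split)
    have comm: "chart_deriv c a (chart_deriv c b (\<lambda>q. \<omega> c q m)) p = chart_deriv c b (chart_deriv c a (\<lambda>q. \<omega> c q m)) p"
      for a b m
      using \<omega> c p unfolding chartwise_smooth_def by (intro chart_deriv_commute[OF M]) auto
    have lower: "t j (i - 1) = - t i j" if "j < i" "i < length l" for i j
      using that comm[of "l ! i" "l ! j"] drop_nth_drop_nth[OF that]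
      by (cases i) (simp_all add: t_def nth_drop_nth add.commute)
    have t_swap: "(case swap x of (i, j) \<Rightarrow> t i j) = - (case x of (i, j) \<Rightarrow> t i j)" if "x \<in> S P Q" for x
    proof (cases x)
      case (Pair i j)
      then show ?thesis
        using that lower[of j i] lower[of i "Suc j"] by (auto simp: swap_def S_def)
    qed
    have "(\<Sum>(i, j)\<in>S P Q. t i j) = (\<Sum>(i, j)\<in>S Q P. - t i j)"
      by (rule sum.reindex_bij_witness[of _ swap swap])
         (use swap_S swap_swap t_swap in \<open>auto simp: case_prod_unfold\<close>)
    then show ?thesis
      using d_part_d_part[OF \<omega> c p] by (simp add: S_def t_def sum_negf case_prod_unfold)
  next
    case False
    then have "d_part P A \<eta> c p l = 0" for P and \<eta> :: "('a, 'n) form"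
      by (auto simp: d_part_def)
    then show ?thesis by simp
  qed
qed

text \<open>A form equal to its own negative vanishes.\<close>

lemma d_part_square:
  assumes "chartwise_smooth A \<omega>"
  shows "d_part P A (d_part P A \<omega>) = 0"
proof (intro ext)
  fix c p l
  have "d_part P A (d_part P A \<omega>) c p l = - d_part P A (d_part P A \<omega>) c p l"
    using fun_cong[OF fun_cong[OF fun_cong[OF d_part_anticommute[OF assms, of P P]]], of c p l]
    by (simp only: fun_Compl_def)
  then show "d_part P A (d_part P A \<omega>) c p l = 0 c p l" by simp
qed

lemma d_part_0: "d_part P A 0 = 0"
  unfolding d_part_def by (auto simp: fun_eq_iff chart_deriv_zero[OF M])

lemma del_bidegree_part: "del A (bidegree_part p q \<omega>) = bidegree_part (Suc p) q (del A \<omega>)"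
proof (intro ext)
  fix c x l
  have "chart_deriv c (l ! i) (\<lambda>y. bidegree_part p q \<omega> c y (drop_nth i l)) x =
      (if bidegree (Suc p) q l then chart_deriv c (l ! i) (\<lambda>y. \<omega> c y (drop_nth i l)) x else 0)"
    if "i < length l" "isl (l ! i)" for i
    using bidegree_drop_nth(1)[OF that] by (simp add: bidegree_part_def chart_deriv_zero[OF M])
  then show "del A (bidegree_part p q \<omega>) c x l = bidegree_part (Suc p) q (del A \<omega>) c x l"
    unfolding del_def d_part_alt by (simp add: bidegree_part_def[of "Suc p"])
qed

lemma delbar_bidegree_part: "delbar A (bidegree_part p q \<omega>) = bidegree_part p (Suc q) (delbar A \<omega>)"
proof (intro ext)
  fix c x l
  have "chart_deriv c (l ! i) (\<lambda>y. bidegree_part p q \<omega> c y (drop_nth i l)) x =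
      (if bidegree p (Suc q) l then chart_deriv c (l ! i) (\<lambda>y. \<omega> c y (drop_nth i l)) x else 0)"
    if "i < length l" "\<not> isl (l ! i)" for i
    using bidegree_drop_nth(2)[OF that] by (simp add: bidegree_part_def chart_deriv_zero[OF M])
  then show "delbar A (bidegree_part p q \<omega>) c x l = bidegree_part p (Suc q) (delbar A \<omega>) c x l"
    unfolding delbar_def d_part_alt by (simp add: bidegree_part_def[of p "Suc q"])
qed

lemma zero_in_forms: "0 \<in> forms A"
  unfolding forms_def by (auto intro: smooth_in_chart_zero[OF M])

lemma forms_add:
  assumes \<omega>: "\<omega> \<in> forms A" and \<eta>: "\<eta> \<in> forms A"
  shows "\<omega> + \<eta> \<in> forms A"
proof (rule formsI)
  show "smooth_in_chart c (\<lambda>p. (\<omega> + \<eta>) c p l)" if "c \<in> A" for c l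
    using chartwise_smooth_add[OF assms[THEN forms_chartwise_smooth]] that unfolding chartwise_smooth_def by blast
  show "(\<omega> + \<eta>) c p l =
      (\<Sum>m | length m = length l. (\<Prod>i<length l. jac c d p (m ! i) (l ! i)) * (\<omega> + \<eta>) d p m)"
    if "c \<in> A" "d \<in> A" "p \<in> fst c \<inter> fst d" for c d p l
    by (simp add: forms_transform[OF \<omega> that, of l] forms_transform[OF \<eta> that, of l] distrib_left sum.distrib)
qed (simp_all add: forms_zero[OF \<omega>] forms_zero[OF \<eta>] forms_antisymmetric[OF \<omega>] forms_antisymmetric[OF \<eta>])

lemma forms_scale:
  assumes \<omega>: "\<omega> \<in> forms A"
  shows "scale k \<omega> \<in> forms A"
proof (rule formsI)
  show "smooth_in_chart c (\<lambda>p. scale k \<omega> c p l)" if "c \<in> A" for c l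
    using chartwise_smooth_scale[OF assms[THEN forms_chartwise_smooth]] that unfolding chartwise_smooth_def by blast
  show "scale k \<omega> c p l =
      (\<Sum>m | length m = length l. (\<Prod>i<length l. jac c d p (m ! i) (l ! i)) * scale k \<omega> d p m)"
    if "c \<in> A" "d \<in> A" "p \<in> fst c \<inter> fst d" for c d p l
    by (simp add: scale_def forms_transform[OF \<omega> that, of l] sum_distrib_left mult.left_commute)
qed (simp_all add: scale_def forms_zero[OF \<omega>] forms_antisymmetric[OF \<omega>])

text \<open>In the transformation law a multi-index \<open>m\<close> whose types differ from those of \<open>l\<close> in some position has
  a factor \<open>jac\<close> equal to zero, so only multi-indices of the bidegree of \<open>l\<close> contribute.\<close>

lemma forms_bidegree_part:
  assumes \<omega>: "\<omega> \<in> forms A"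
  shows "bidegree_part p q \<omega> \<in> forms A"
proof -
  have transform: "bidegree_part p q \<omega> c x l =
      (\<Sum>m | length m = length l. (\<Prod>i<length l. jac c d x (m ! i) (l ! i)) * bidegree_part p q \<omega> d x m)"
    if c: "c \<in> A" and d: "d \<in> A" and x: "x \<in> fst c \<inter> fst d" for c d x l
  proof -
    have "(\<Prod>i<length l. jac c d x (m ! i) (l ! i)) * bidegree_part p q \<omega> d x m =
        (if bidegree p q l then (\<Prod>i<length l. jac c d x (m ! i) (l ! i)) * \<omega> d x m else 0)"
      if m: "length m = length l" for m
    proof (cases "\<forall>i<length l. isl (m ! i) = isl (l ! i)")
      case True
      then show ?thesis using bidegree_cong[OF m] by (simp add: bidegree_part_def)
    next
      case False
      then obtain i where "i < length l" "isl (l ! i) \<noteq> isl (m ! i)" by auto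
      then have "(\<Prod>i<length l. jac c d x (m ! i) (l ! i)) = 0"
        using jac_eq_0[OF M c d x] by (intro prod_zero) auto
      then show ?thesis by simp
    qed
    then have "(\<Sum>m | length m = length l. (\<Prod>i<length l. jac c d x (m ! i) (l ! i)) * bidegree_part p q \<omega> d x m) =
        (if bidegree p q l
         then \<Sum>m | length m = length l. (\<Prod>i<length l. jac c d x (m ! i) (l ! i)) * \<omega> d x m else 0)"
      by simp
    also have "\<dots> = bidegree_part p q \<omega> c x l"
      using forms_transform[OF \<omega> c d x, of l] by (simp add: bidegree_part_def)
    finally show ?thesis ..
  qed
  show ?thesis
  proof (rule formsI[OF _ _ _ transform])
    show "bidegree_part p q \<omega> c x l = 0" if "\<not> (c \<in> A \<and> x \<in> fst c)" for c x l
      using forms_zero[OF \<omega> that] by (simp add: bidegree_part_def)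
    show "bidegree_part p q \<omega> c x (l[i := l ! j, j := l ! i]) = - bidegree_part p q \<omega> c x l"
      if "i < j" "j < length l" for c x l i j
      using forms_antisymmetric[OF \<omega> that] that bidegree_swap[of i l j p q] by (simp add: bidegree_part_def)
    show "smooth_in_chart c (\<lambda>x. bidegree_part p q \<omega> c x l)" if "c \<in> A" for c l
      using forms_chartwise_smooth[OF \<omega>] that unfolding chartwise_smooth_def bidegree_part_def
      by (cases "bidegree p q l") (auto intro: smooth_in_chart_zero[OF M])
  qed
qed

end


section \<open>Exterior derivatives of functions and one-forms\<close>

text \<open>Total degree, used instead of bidegree for the exterior derivative, which mixes bidegrees.\<close>

definition homogeneous :: "nat \<Rightarrow> ('a, 'n::finite) form \<Rightarrow> bool" where
  "homogeneous k \<omega> \<longleftrightarrow> (\<forall>c p l. length l \<noteq> k \<longrightarrow> \<omega> c p l = 0)"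

lemma homogeneous_bidegree_part: "homogeneous (p + q) (bidegree_part p q \<omega>)"
  unfolding homogeneous_def bidegree_part_def using bidegree_length by auto

lemma homogeneous_add: "homogeneous k \<omega> \<Longrightarrow> homogeneous k \<eta> \<Longrightarrow> homogeneous k (\<omega> + \<eta>)"
  unfolding homogeneous_def by auto

lemma ext_d_one_index:
  "c \<in> A \<Longrightarrow> p \<in> fst c \<Longrightarrow> ext_d A \<omega> c p [a] = chart_deriv c a (\<lambda>q. \<omega> c q []) p"
  by (simp add: ext_d_def d_part_def)

lemma ext_d_two_indices:
  assumes "c \<in> A" "p \<in> fst c"
  shows "ext_d A \<omega> c p [a, b] = chart_deriv c a (\<lambda>q. \<omega> c q [b]) p - chart_deriv c b (\<lambda>q. \<omega> c q [a]) p"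
proof -
  have "{i. i < Suc (Suc 0)} = {0, Suc 0}" by auto
  with assms show ?thesis by (simp add: ext_d_def d_part_def)
qed

context
  fixes X :: "'a topology" and A :: "('a, 'n::finite) chart set"
  assumes M: "complex_manifold X A"
begin

lemma ext_d_homogeneous:
  assumes "homogeneous k \<omega>"
  shows "homogeneous (Suc k) (ext_d A \<omega>)"
  unfolding homogeneous_def
proof (intro allI impI)
  fix c p and l :: "('n + 'n) list"
  assume "length l \<noteq> Suc k"
  then have "length (drop_nth i l) \<noteq> k" if "i < length l" for i
    using that by (simp add: length_drop_nth)
  then have "\<omega> c q (drop_nth i l) = 0" if "i < length l" for i q
    using assms that unfolding homogeneous_def by blast
  then show "ext_d A \<omega> c p l = 0"
    by (simp add: ext_d_def d_part_alt chart_deriv_zero[OF M])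
qed

lemma ext_d_zero_outside: "\<not> (c \<in> A \<and> p \<in> fst c) \<Longrightarrow> ext_d A \<omega> c p l = 0"
  by (auto simp: ext_d_def d_part_def)

text \<open>The transformation law of the differential of a function is the chain rule.\<close>

lemma ext_d_function_in_forms:
  assumes f: "f \<in> forms A" and hom: "homogeneous 0 f"
  shows "ext_d A f \<in> forms A"
proof (rule formsI)
  have hom1: "ext_d A f c p l = 0" if "length l \<noteq> Suc 0" for c p l
    using ext_d_homogeneous[OF hom] that unfolding homogeneous_def by blast
  show "ext_d A f c p (l[i := l ! j, j := l ! i]) = - ext_d A f c p l" if "i < j" "j < length l" for c p l i j
    using that by (subst (1 2) hom1) auto
  show "smooth_in_chart c (\<lambda>p. ext_d A f c p l)" if "c \<in> A" for c l
    unfolding ext_d_def by (rule smooth_in_chart_d_part[OF M forms_chartwise_smooth[OF f] that])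
  show "ext_d A f c p l = (\<Sum>m | length m = length l. (\<Prod>i<length l. jac c d p (m ! i) (l ! i)) * ext_d A f d p m)"
    if c: "c \<in> A" and d: "d \<in> A" and p: "p \<in> fst c \<inter> fst d" for c d p l
  proof (cases "length l = Suc 0")
    case True
    then obtain a where l: "l = [a]" by (auto simp: length_Suc_conv)
    have "ext_d A f c p [a] = chart_deriv c a (\<lambda>q. f c q []) p"
      using c p by (simp add: ext_d_one_index)
    also have "\<dots> = chart_deriv c a (\<lambda>q. f d q []) p"
      by (rule chart_deriv_cong[OF M c d p]) (use forms_transform[OF f c d, of _ "[]"] in simp)
    also have "\<dots> = (\<Sum>b\<in>UNIV. jac c d p b a * chart_deriv d b (\<lambda>q. f d q []) p)"
      using forms_chartwise_smooth[OF f] d unfolding chartwise_smooth_def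
      by (intro chart_deriv_transform[OF M c d p]) auto
    also have "\<dots> = (\<Sum>b\<in>UNIV. jac c d p b a * ext_d A f d p [b])"
      using d p by (simp add: ext_d_one_index)
    finally show ?thesis by (simp add: l sum_lists_1)
  next
    case False
    then show ?thesis by (simp add: hom1)
  qed
qed (rule ext_d_zero_outside)

text \<open>Differentiating the transformation law of \<open>\<omega>\<close> produces a tensorial part and a part \<open>H\<close> with second
  derivatives of the transition map. The latter is symmetric in the two arguments and cancels in the
  antisymmetrization.\<close>

lemma ext_d_one_form_transform:
  assumes \<omega>: "\<omega> \<in> forms A" and c: "c \<in> A" and d: "d \<in> A" and p: "p \<in> fst c \<inter> fst d"
  shows "ext_d A \<omega> c p [a, b] =
    (\<Sum>m\<in>UNIV. \<Sum>n\<in>UNIV. jac c d p m a * jac c d p n b * ext_d A \<omega> d p [m, n])"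
proof -
  define J where "J = jac c d p"
  define K where "K n m = chart_deriv d n (\<lambda>q. \<omega> d q [m]) p" for n m
  define H where "H m b a = chart_deriv c a (\<lambda>q. jac c d q m b) p" for m b a
  have smooth: "smooth_in_chart d (\<lambda>q. \<omega> d q [m])" for m
    using forms_chartwise_smooth[OF \<omega>] d unfolding chartwise_smooth_def by blast
  have deriv: "chart_deriv c a (\<lambda>q. \<omega> c q [b]) p =
      (\<Sum>m\<in>UNIV. H m b a * \<omega> d p [m]) + (\<Sum>m\<in>UNIV. \<Sum>n\<in>UNIV. J m b * J n a * K n m)" for a b
  proof -
    have "chart_deriv c a (\<lambda>q. \<omega> c q [b]) p =
        (\<Sum>m\<in>UNIV. H m b a * \<omega> d p [m] + J m b * chart_deriv c a (\<lambda>q. \<omega> d q [m]) p)"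
      unfolding H_def J_def
      by (rule chart_deriv_pullback[OF M c d p smooth])
         (use forms_transform[OF \<omega> c d, of _ "[b]"] in \<open>simp add: sum_lists_1\<close>)
    then show ?thesis
      by (simp add: chart_deriv_transform[OF M c d p smooth] sum.distrib sum_distrib_left mult.assoc J_def K_def)
  qed
  have "H m b a = H m a b" for m
    unfolding H_def by (rule chart_deriv_jac_symmetric[OF M c d p])
  then have "ext_d A \<omega> c p [a, b] =
      (\<Sum>m\<in>UNIV. \<Sum>n\<in>UNIV. J m b * J n a * K n m) - (\<Sum>m\<in>UNIV. \<Sum>n\<in>UNIV. J m a * J n b * K n m)"
    using c p by (simp add: ext_d_two_indices deriv)
  also have "(\<Sum>m\<in>UNIV. \<Sum>n\<in>UNIV. J m b * J n a * K n m) = (\<Sum>m\<in>UNIV. \<Sum>n\<in>UNIV. J m a * J n b * K m n)"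
    by (subst sum.swap) (simp add: mult.commute)
  finally show ?thesis
    using d p by (simp add: ext_d_two_indices J_def K_def sum_subtractf right_diff_distrib)
qed

lemma ext_d_one_form_in_forms:
  assumes \<omega>: "\<omega> \<in> forms A" and hom: "homogeneous 1 \<omega>"
  shows "ext_d A \<omega> \<in> forms A"
proof (rule formsI)
  have hom2: "ext_d A \<omega> c p l = 0" if "length l \<noteq> Suc (Suc 0)" for c p l
    using ext_d_homogeneous[OF hom] that unfolding homogeneous_def One_nat_def by blast
  show "ext_d A \<omega> c p (l[i := l ! j, j := l ! i]) = - ext_d A \<omega> c p l" if "i < j" "j < length l" for c p l i j
  proof (cases "length l = Suc (Suc 0) \<and> c \<in> A \<and> p \<in> fst c")
    case True
    then obtain a b where "l = [a, b]" by (auto simp: length_Suc_conv)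
    moreover have "i = 0" "j = 1" using that True by linarith+
    ultimately show ?thesis using True by (simp add: ext_d_two_indices)
  next
    case False
    then have "ext_d A \<omega> c p m = 0" if "length m = length l" for m
      using hom2[of m c p] ext_d_zero_outside[of c p] that by metis
    then show ?thesis by simp
  qed
  show "smooth_in_chart c (\<lambda>p. ext_d A \<omega> c p l)" if "c \<in> A" for c l
    unfolding ext_d_def by (rule smooth_in_chart_d_part[OF M forms_chartwise_smooth[OF \<omega>] that])
  show "ext_d A \<omega> c p l = (\<Sum>m | length m = length l. (\<Prod>i<length l. jac c d p (m ! i) (l ! i)) * ext_d A \<omega> d p m)"
    if c: "c \<in> A" and d: "d \<in> A" and p: "p \<in> fst c \<inter> fst d" for c d p l
  proof (cases "length l = Suc (Suc 0)")
    case True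
    then obtain a b where l: "l = [a, b]" by (auto simp: length_Suc_conv)
    show ?thesis
      using ext_d_one_form_transform[OF \<omega> c d p, of a b] by (simp add: l sum_lists_2 lessThan_Suc mult.commute)
  next
    case False
    then show ?thesis by (simp add: hom2)
  qed
qed (rule ext_d_zero_outside)

end

section \<open>Cohomology classes and exact forms of bidegree (1,1)\<close>

text \<open>The blocks of the partition are translates of \<open>B\<close> intersected with \<open>Z\<close>, so all blocks that contain
  \<open>\<omega>\<close> coincide.\<close>

lemma class_of_closed:
  assumes \<omega>: "\<omega> \<in> Z" and B0: "0 \<in> B" and B: "\<And>x y. x \<in> B \<Longrightarrow> y \<in> B \<Longrightarrow> x - y \<in> B"
  shows "cclass (cohomology Z B) \<omega> = {\<eta> \<in> Z. \<eta> - \<omega> \<in> B}"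
proof (intro equalityI subsetI)
  fix \<eta>
  assume "\<eta> \<in> cclass (cohomology Z B) \<omega>"
  then obtain \<zeta> where "\<omega> - \<zeta> \<in> B" "\<eta> - \<zeta> \<in> B" "\<eta> \<in> Z"
    unfolding cclass_def cohomology_def quotient_def by auto
  then show "\<eta> \<in> {\<eta> \<in> Z. \<eta> - \<omega> \<in> B}" using B[of "\<eta> - \<zeta>" "\<omega> - \<zeta>"] by simp
next
  fix \<eta>
  assume \<eta>: "\<eta> \<in> {\<eta> \<in> Z. \<eta> - \<omega> \<in> B}"
  have "{\<eta> \<in> Z. \<eta> - \<omega> \<in> B} \<in> cohomology Z B"
    using \<omega> unfolding cohomology_def quotient_def by auto
  with \<eta> \<omega> B0 show "\<eta> \<in> cclass (cohomology Z B) \<omega>"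
    unfolding cclass_def by (intro UnionI) auto
qed

lemma class_of_non_closed: "\<omega> \<notin> Z \<Longrightarrow> cclass (cohomology Z B) \<omega> = {}"
  unfolding cclass_def cohomology_def quotient_def by auto

text \<open>A representative that is not in \<open>Z\<close> has the empty class and contributes nothing to the union,
  whereas the zero class contains \<open>0\<close>. So the union is the zero class if and only if some
  representative lies in \<open>Z\<close> and all representatives in \<open>Z\<close> lie in \<open>B\<close>. The first conjunct is the same
  for all three Chern classes, and what is left is to compare the sets of exact forms.\<close>

lemma union_of_classes_eq_zero_iff:
  assumes Z0: "0 \<in> Z" and B0: "0 \<in> B" and B: "\<And>x y. x \<in> B \<Longrightarrow> y \<in> B \<Longrightarrow> x - y \<in> B"
  shows "(\<Union>h\<in>I. cclass (cohomology Z B) (\<Theta> h)) = cclass (cohomology Z B) 0 \<longleftrightarrow>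
    (\<exists>h\<in>I. \<Theta> h \<in> Z) \<and> (\<forall>h\<in>I. \<Theta> h \<in> Z \<longrightarrow> \<Theta> h \<in> B)"
proof -
  have zero: "cclass (cohomology Z B) 0 = {\<eta> \<in> Z. \<eta> \<in> B}"
    using class_of_closed[OF Z0 B0 B] by simp
  show ?thesis
  proof
    assume eq: "(\<Union>h\<in>I. cclass (cohomology Z B) (\<Theta> h)) = cclass (cohomology Z B) 0"
    have "0 \<in> cclass (cohomology Z B) 0" unfolding zero using Z0 B0 by simp
    then have "\<exists>h\<in>I. \<Theta> h \<in> Z" unfolding eq[symmetric] using class_of_non_closed by blast
    moreover have "\<Theta> h \<in> B" if "h \<in> I" "\<Theta> h \<in> Z" for h
    proof -
      have "\<Theta> h \<in> cclass (cohomology Z B) (\<Theta> h)" using class_of_closed[OF that(2) B0 B] that B0 by simp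
      then have "\<Theta> h \<in> cclass (cohomology Z B) 0" using that eq by blast
      then show ?thesis unfolding zero by simp
    qed
    ultimately show "(\<exists>h\<in>I. \<Theta> h \<in> Z) \<and> (\<forall>h\<in>I. \<Theta> h \<in> Z \<longrightarrow> \<Theta> h \<in> B)" by blast
  next
    assume R: "(\<exists>h\<in>I. \<Theta> h \<in> Z) \<and> (\<forall>h\<in>I. \<Theta> h \<in> Z \<longrightarrow> \<Theta> h \<in> B)"
    have "cclass (cohomology Z B) (\<Theta> h) = cclass (cohomology Z B) 0" if "h \<in> I" "\<Theta> h \<in> Z" for h
    proof -
      have "\<Theta> h \<in> B" using R that by blast
      then have "\<eta> - \<Theta> h \<in> B \<longleftrightarrow> \<eta> \<in> B" for \<eta>
        using B[of "\<eta> - \<Theta> h" "0 - \<Theta> h"] B[of 0 "\<Theta> h"] B[of \<eta> "\<Theta> h"] B0 by auto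
      then show ?thesis using class_of_closed[OF that(2) B0 B] zero by simp
    qed
    then show "(\<Union>h\<in>I. cclass (cohomology Z B) (\<Theta> h)) = cclass (cohomology Z B) 0"
      using R class_of_non_closed by blast
  qed
qed

definition exact_BC :: "('a, 'n::finite) chart set \<Rightarrow> ('a, 'n) form set" where
  "exact_BC A = (\<lambda>\<eta>. del A (delbar A \<eta>)) ` forms A \<inter> forms_pq A 1 1"

definition exact_delbar :: "('a, 'n::finite) chart set \<Rightarrow> ('a, 'n) form set" where
  "exact_delbar A = delbar A ` forms A \<inter> forms_pq A 1 1"

definition exact_A :: "('a, 'n::finite) chart set \<Rightarrow> ('a, 'n) form set" where
  "exact_A A = {\<alpha> + \<beta> | \<alpha> \<beta>.
     \<alpha> \<in> del A ` forms A \<inter> forms_pq A 1 1 \<and> \<beta> \<in> delbar A ` forms A \<inter> forms_pq A 1 1}"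

context
  fixes X :: "'a topology" and A :: "('a, 'n::finite) chart set"
  assumes M: "complex_manifold X A"
begin

lemma diff_eq_add_scale: "\<omega> - \<eta> = \<omega> + scale (-1) \<eta>"
  by (auto simp: scale_def fun_eq_iff)

lemma forms_diff: "\<omega> \<in> forms A \<Longrightarrow> \<eta> \<in> forms A \<Longrightarrow> \<omega> - \<eta> \<in> forms A"
  unfolding diff_eq_add_scale by (intro forms_add[OF M] forms_scale[OF M])

lemma d_part_diff:
  "chartwise_smooth A \<omega> \<Longrightarrow> chartwise_smooth A \<eta> \<Longrightarrow> d_part P A (\<omega> - \<eta>) = d_part P A \<omega> - d_part P A \<eta>"
  unfolding diff_eq_add_scale by (simp add: d_part_add[OF M] d_part_scale[OF M] chartwise_smooth_scale[OF M])

lemma forms_pq_zero: "0 \<in> forms_pq A p q"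
  using zero_in_forms[OF M] unfolding forms_pq_iff by (simp add: bidegree_part_def fun_eq_iff)

lemma forms_pq_diff: "\<omega> \<in> forms_pq A p q \<Longrightarrow> \<eta> \<in> forms_pq A p q \<Longrightarrow> \<omega> - \<eta> \<in> forms_pq A p q"
  using forms_diff unfolding forms_pq_iff by (simp add: bidegree_part_diff)

lemma d_part_image_diff:
  assumes "x \<in> d_part P A ` forms A" "y \<in> d_part P A ` forms A"
  shows "x - y \<in> d_part P A ` forms A"
  using assms d_part_diff[OF forms_chartwise_smooth forms_chartwise_smooth] forms_diff
  by (smt (verit) image_iff)

lemma del_delbar_image_diff:
  assumes "x \<in> (\<lambda>\<eta>. del A (delbar A \<eta>)) ` forms A" "y \<in> (\<lambda>\<eta>. del A (delbar A \<eta>)) ` forms A"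
  shows "x - y \<in> (\<lambda>\<eta>. del A (delbar A \<eta>)) ` forms A"
proof -
  obtain a b where ab: "a \<in> forms A" "b \<in> forms A" and xy: "x = del A (delbar A a)" "y = del A (delbar A b)"
    using assms by blast
  have "del A (delbar A (a - b)) = x - y"
    unfolding xy del_def delbar_def using ab
    by (simp add: d_part_diff forms_chartwise_smooth chartwise_smooth_d_part[OF M])
  then show ?thesis using forms_diff[OF ab] by (metis image_eqI)
qed

text \<open>For a function \<open>f\<close> one has $\partial\bar\partial f = \bar\partial(-\partial f)$, and $-\partial f$ is a
  global form. A potential \<open>\<eta>\<close> of mixed degree is first replaced by its part of bidegree $(0,0)$, which
  alone contributes to bidegree $(1,1)$.\<close>

lemma del_delbar_exact_imp_delbar_exact:
  assumes \<Theta>: "\<Theta> \<in> forms_pq A 1 1" and ex: "\<Theta> \<in> (\<lambda>\<eta>. del A (delbar A \<eta>)) ` forms A"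
  shows "\<Theta> \<in> delbar A ` forms A"
proof -
  obtain \<eta> where \<eta>: "\<eta> \<in> forms A" "\<Theta> = del A (delbar A \<eta>)" using ex by blast
  define f where "f = bidegree_part 0 0 \<eta>"
  have f: "f \<in> forms A" "homogeneous 0 f"
    unfolding f_def using forms_bidegree_part[OF M \<eta>(1)] homogeneous_bidegree_part[of 0 0] by auto
  have "del A f = bidegree_part 1 0 (ext_d A f)"
    unfolding f_def ext_d_eq bidegree_part_add del_bidegree_part[OF M] delbar_bidegree_part[OF M]
    by (auto simp: bidegree_part_def bidegree_def fun_eq_iff)
  then have df: "del A f \<in> forms A"
    using forms_bidegree_part[OF M ext_d_function_in_forms[OF M f]] by simp
  have "\<Theta> = bidegree_part 1 1 \<Theta>" using \<Theta> unfolding forms_pq_iff by simp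
  also have "\<dots> = del A (delbar A f)"
    unfolding f_def \<eta>(2) del_bidegree_part[OF M] delbar_bidegree_part[OF M] by simp
  also have "\<dots> = - delbar A (del A f)"
    unfolding del_def delbar_def by (rule d_part_anticommute[OF M forms_chartwise_smooth[OF f(1)]])
  also have "\<dots> = delbar A (scale (-1) (del A f))"
    using d_part_scale[OF M forms_chartwise_smooth[OF df], of _ "-1"] by (simp add: minus_eq_scale delbar_def)
  finally show ?thesis using forms_scale[OF M df] by blast
qed

text \<open>Inside each chart $\Theta$ is a multiple of $\partial\bar\partial$ of a smooth function, and
  $\partial\partial\bar\partial = 0$, $\bar\partial\partial\bar\partial =
  -\partial\bar\partial\bar\partial = 0$.\<close>

lemma curvature_closed:
  assumes h: "h \<in> hermitian_metrics A"
  shows "del A (curvature A h) = 0" "delbar A (curvature A h) = 0"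
proof -
  define L :: "('a, 'n) form" where "L = (\<lambda>c p l. if l = [] then complex_of_real (ln (h c p)) else 0)"
  have L: "chartwise_smooth A L"
    unfolding chartwise_smooth_def
  proof (intro ballI allI)
    fix c and l :: "('n + 'n) list"
    assume c: "c \<in> A"
    have "smooth_in_chart c (h c)" and pos: "\<And>p. p \<in> fst c \<Longrightarrow> h c p > 0"
      using h c unfolding hermitian_metrics_def by blast+
    then have "smooth_on (snd c ` fst c) (\<lambda>z. ln (h c (inv_into (fst c) (snd c) z)))"
      unfolding smooth_in_chart_def o_def
      by (intro smooth_on_ln[OF chart_image_open[OF M c]]) (auto simp: chart_inv[OF M c])
    then have "smooth_in_chart c (\<lambda>p. complex_of_real (ln (h c p)))"
      unfolding smooth_in_chart_def o_def
      by (intro smooth_on_bounded_linear[OF bounded_linear_of_real chart_image_open[OF M c]])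
    then show "smooth_in_chart c (\<lambda>p. L c p l)"
      unfolding L_def by (cases "l = []") (auto intro: smooth_in_chart_zero[OF M c])
  qed
  have curv: "curvature A h = scale (- \<i>) (del A (delbar A L))"
    unfolding curvature_def scale_def L_def by simp
  note smooth = L chartwise_smooth_d_part[OF M]
  have "del A (del A (delbar A L)) = 0"
    unfolding del_def delbar_def by (intro d_part_square[OF M] smooth)
  then show "del A (curvature A h) = 0"
    unfolding curv del_def delbar_def by (subst d_part_scale[OF M]) (intro smooth, simp add: scale_def fun_eq_iff)
  have "delbar A (del A (delbar A L)) = - del A (delbar A (delbar A L))"
    unfolding del_def delbar_def by (intro d_part_anticommute[OF M] smooth)
  also have "delbar A (delbar A L) = 0"
    unfolding delbar_def by (intro d_part_square[OF M] smooth)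
  also have "- del A 0 = 0" unfolding del_def by (simp add: d_part_0[OF M])
  finally show "delbar A (curvature A h) = 0"
    unfolding curv del_def delbar_def by (subst d_part_scale[OF M]) (intro smooth, simp add: scale_def fun_eq_iff)
qed

text \<open>The form to which the $\partial\bar\partial$-lemma applies is not $\Theta$, which is not visibly
  $d$-exact, but $d\eta$ for the one-form $\eta = a + b$ built from the potentials of $\Theta$. Its
  $(1,1)$ part is $\Theta$. It is closed for both operators because
  $\partial d\eta = \partial\bar\partial\eta = -\bar\partial d\eta$ and
  $\partial\bar\partial\eta = \partial\bar\partial b - \bar\partial\partial a
    = \partial\Theta - \bar\partial\Theta = 0$.\<close>

lemma aeppli_exact_imp_del_delbar_exact:
  assumes lemma_holds: "ddbar_lemma A" and \<Theta>: "\<Theta> \<in> forms_pq A 1 1"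
    and closed: "del A \<Theta> = 0" "delbar A \<Theta> = 0"
    and \<alpha>: "\<alpha> \<in> forms A" and \<beta>: "\<beta> \<in> forms A" and eq: "\<Theta> = del A \<alpha> + delbar A \<beta>"
  shows "\<Theta> \<in> (\<lambda>\<eta>. del A (delbar A \<eta>)) ` forms A"
proof -
  \<comment> \<open>only these parts of the potentials contribute to bidegree $(1,1)$\<close>
  define a where "a = bidegree_part 0 1 \<alpha>"
  define b where "b = bidegree_part 1 0 \<beta>"
  have a: "a \<in> forms A" and b: "b \<in> forms A"
    unfolding a_def b_def by (intro forms_bidegree_part[OF M] \<alpha> \<beta>)+
  note smooth = forms_chartwise_smooth[OF a] forms_chartwise_smooth[OF b] chartwise_smooth_d_part[OF M]
  have \<Theta>_eq: "\<Theta> = del A a + delbar A b"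
  proof -
    have "\<Theta> = bidegree_part 1 1 \<Theta>" using \<Theta> unfolding forms_pq_iff by simp
    then show ?thesis
      unfolding eq a_def b_def del_bidegree_part[OF M] delbar_bidegree_part[OF M] bidegree_part_add by simp
  qed
  have "del A (delbar A b) = del A (del A a) + del A (delbar A b)"
    unfolding del_def using d_part_square[OF M smooth(1)] by simp
  also have "\<dots> = del A \<Theta>"
    unfolding \<Theta>_eq del_def delbar_def by (rule d_part_add[OF M, symmetric]; intro smooth)
  finally have deldelbar_b: "del A (delbar A b) = 0" using closed by simp
  have "delbar A (del A a) = delbar A (del A a) + delbar A (delbar A b)"
    unfolding delbar_def using d_part_square[OF M smooth(2)] by simp
  also have "\<dots> = delbar A \<Theta>"
    unfolding \<Theta>_eq del_def delbar_def by (rule d_part_add[OF M, symmetric]; intro smooth)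
  finally have delbardel_a: "delbar A (del A a) = 0" using closed by simp
  define \<eta> where "\<eta> = a + b"
  have \<eta>: "\<eta> \<in> forms A" unfolding \<eta>_def by (rule forms_add[OF M a b])
  note smooth_\<eta> = forms_chartwise_smooth[OF \<eta>] chartwise_smooth_d_part[OF M]
  have del_delbar_\<eta>: "del A (delbar A \<eta>) = 0"
  proof -
    have "del A (delbar A \<eta>) = del A (delbar A a) + del A (delbar A b)"
      unfolding \<eta>_def del_def delbar_def using smooth by (simp add: d_part_add[OF M])
    also have "del A (delbar A a) = - delbar A (del A a)"
      unfolding del_def delbar_def by (rule d_part_anticommute[OF M smooth(1)])
    finally show ?thesis using deldelbar_b delbardel_a by (simp add: fun_eq_iff)
  qed
  have "homogeneous 1 \<eta>"
    unfolding \<eta>_def a_def b_def using homogeneous_bidegree_part[of 0 1 \<alpha>] homogeneous_bidegree_part[of 1 0 \<beta>]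
    by (intro homogeneous_add) simp_all
  then have "ext_d A \<eta> \<in> forms A" by (rule ext_d_one_form_in_forms[OF M \<eta>])
  moreover have "del A (ext_d A \<eta>) = 0"
  proof -
    have "del A (ext_d A \<eta>) = del A (del A \<eta>) + del A (delbar A \<eta>)"
      unfolding ext_d_eq del_def delbar_def by (intro d_part_add[OF M] smooth_\<eta>)
    then show ?thesis using del_delbar_\<eta> d_part_square[OF M smooth_\<eta>(1)] by (simp add: del_def)
  qed
  moreover have "delbar A (ext_d A \<eta>) = 0"
  proof -
    have "delbar A (ext_d A \<eta>) = delbar A (del A \<eta>) + delbar A (delbar A \<eta>)"
      unfolding ext_d_eq del_def delbar_def by (intro d_part_add[OF M] smooth_\<eta>)
    also have "delbar A (del A \<eta>) = - del A (delbar A \<eta>)"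
      unfolding del_def delbar_def by (rule d_part_anticommute[OF M smooth_\<eta>(1)])
    finally show ?thesis
      using del_delbar_\<eta> d_part_square[OF M smooth_\<eta>(1)] by (simp add: delbar_def fun_eq_iff)
  qed
  ultimately obtain \<gamma> where \<gamma>: "\<gamma> \<in> forms A" "ext_d A \<eta> = del A (delbar A \<gamma>)"
    using lemma_holds \<eta> unfolding ddbar_lemma_def by blast
  have "\<Theta> = bidegree_part 1 1 (ext_d A \<eta>)"
  proof -
    have "bidegree_part 0 1 \<eta> = a" "bidegree_part 1 0 \<eta> = b"
      unfolding \<eta>_def a_def b_def by (auto simp: bidegree_part_def bidegree_def fun_eq_iff)
    then show ?thesis
      unfolding \<Theta>_eq ext_d_eq bidegree_part_add
      using del_bidegree_part[OF M, of 0 1 \<eta>] delbar_bidegree_part[OF M, of 1 0 \<eta>] by simp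
  qed
  also have "\<dots> = del A (delbar A (bidegree_part 0 0 \<gamma>))"
    unfolding \<gamma>(2) del_bidegree_part[OF M] delbar_bidegree_part[OF M] by simp
  finally show ?thesis using forms_bidegree_part[OF M \<gamma>(1)] by blast
qed

lemma zero_exact: "0 \<in> del A ` forms A" "0 \<in> delbar A ` forms A" "0 \<in> (\<lambda>\<eta>. del A (delbar A \<eta>)) ` forms A"
  using zero_in_forms[OF M] d_part_0[OF M] unfolding del_def delbar_def by (metis image_eqI)+

section \<open>Vanishing of the first Chern classes\<close>

text \<open>Once a curvature is a $(1,1)$-form, it is closed in the sense of each of the three cohomologies by
  \<open>curvature_closed\<close>. Hence this criterion and the next two differ in the last set only.\<close>

lemma c1_BC_eq_0_iff:
  "c1_BC A = cclass (H_BC A 1 1) 0 \<longleftrightarrow>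
    (\<exists>h\<in>hermitian_metrics A. curvature A h \<in> forms_pq A 1 1) \<and>
    (\<forall>h\<in>hermitian_metrics A. curvature A h \<in> forms_pq A 1 1 \<longrightarrow> curvature A h \<in> exact_BC A)"
proof -
  have "ext_d A (0 :: ('a, 'n) form) = 0" unfolding ext_d_def by (rule d_part_0[OF M])
  moreover have "ext_d A (curvature A h) = 0" if "h \<in> hermitian_metrics A" for h
    using curvature_closed[OF that] by (simp add: ext_d_eq)
  ultimately show ?thesis
    unfolding c1_BC_def H_BC_def exact_BC_def[symmetric]
    by (subst union_of_classes_eq_zero_iff)
       (auto simp: exact_BC_def forms_pq_zero intro: zero_exact forms_pq_diff del_delbar_image_diff)
qed

lemma c1_eq_0_iff:
  "c1 A = cclass (H_delbar A 1 1) 0 \<longleftrightarrow>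
    (\<exists>h\<in>hermitian_metrics A. curvature A h \<in> forms_pq A 1 1) \<and>
    (\<forall>h\<in>hermitian_metrics A. curvature A h \<in> forms_pq A 1 1 \<longrightarrow> curvature A h \<in> exact_delbar A)"
proof -
  have "delbar A (0 :: ('a, 'n) form) = 0" unfolding delbar_def by (rule d_part_0[OF M])
  moreover have "x - y \<in> delbar A ` forms A" if "x \<in> delbar A ` forms A" "y \<in> delbar A ` forms A" for x y
    using that unfolding delbar_def by (rule d_part_image_diff)
  ultimately show ?thesis
    unfolding c1_def H_delbar_def exact_delbar_def[symmetric]
    by (subst union_of_classes_eq_zero_iff)
       (auto simp: exact_delbar_def forms_pq_zero curvature_closed intro: zero_exact forms_pq_diff)
qed

lemma c1_AC_eq_0_iff:
  "c1_AC A = cclass (H_A A 1 1) 0 \<longleftrightarrow>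
    (\<exists>h\<in>hermitian_metrics A. curvature A h \<in> forms_pq A 1 1) \<and>
    (\<forall>h\<in>hermitian_metrics A. curvature A h \<in> forms_pq A 1 1 \<longrightarrow> curvature A h \<in> exact_A A)"
proof -
  have 0: "del A (0 :: ('a, 'n) form) = 0" "delbar A (0 :: ('a, 'n) form) = 0"
    unfolding del_def delbar_def by (rule d_part_0[OF M])+
  have closed: "del A (delbar A (curvature A h)) = 0" if "h \<in> hermitian_metrics A" for h
    using curvature_closed[OF that] 0 by simp
  have "0 \<in> exact_A A"
    unfolding exact_A_def using zero_exact forms_pq_zero by (force intro: exI[of _ 0])
  moreover have "x - y \<in> exact_A A" if xy: "x \<in> exact_A A" "y \<in> exact_A A" for x y
  proof -
    obtain \<alpha> \<beta> \<alpha>' \<beta>' where "x = \<alpha> + \<beta>" "y = \<alpha>' + \<beta>'"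
      and \<alpha>: "\<alpha> \<in> del A ` forms A \<inter> forms_pq A 1 1" "\<alpha>' \<in> del A ` forms A \<inter> forms_pq A 1 1"
      and \<beta>: "\<beta> \<in> delbar A ` forms A \<inter> forms_pq A 1 1" "\<beta>' \<in> delbar A ` forms A \<inter> forms_pq A 1 1"
      using xy unfolding exact_A_def by blast
    then have "x - y = (\<alpha> - \<alpha>') + (\<beta> - \<beta>')" by simp
    moreover have "\<alpha> - \<alpha>' \<in> del A ` forms A \<inter> forms_pq A 1 1" "\<beta> - \<beta>' \<in> delbar A ` forms A \<inter> forms_pq A 1 1"
      using \<alpha> \<beta> d_part_image_diff forms_pq_diff unfolding del_def delbar_def by blast+
    ultimately show ?thesis unfolding exact_A_def by blast
  qed
  ultimately show ?thesis
    unfolding c1_AC_def H_A_def exact_A_def[symmetric]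
    by (subst union_of_classes_eq_zero_iff) (auto simp: forms_pq_zero closed 0)
qed

end

theorem corollary1p3:
  fixes X :: "'a topology" and A :: "('a, 'n::finite) chart set"
  assumes "complex_manifold X A"
  shows "(c1_BC A = cclass (H_BC A 1 1) 0 \<longrightarrow> c1 A = cclass (H_delbar A 1 1) 0) \<and>
         (c1 A = cclass (H_delbar A 1 1) 0 \<longrightarrow> c1_AC A = cclass (H_A A 1 1) 0) \<and>
         (compact_space X \<and> ddbar_lemma A \<longrightarrow>
           (c1_BC A = cclass (H_BC A 1 1) 0 \<longleftrightarrow> c1 A = cclass (H_delbar A 1 1) 0) \<and>
           (c1 A = cclass (H_delbar A 1 1) 0 \<longleftrightarrow> c1_AC A = cclass (H_A A 1 1) 0))"
proof -
  note iff = c1_BC_eq_0_iff[OF assms] c1_eq_0_iff[OF assms] c1_AC_eq_0_iff[OF assms]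
  have BC_delbar: "exact_BC A \<subseteq> exact_delbar A"
    using del_delbar_exact_imp_delbar_exact[OF assms] unfolding exact_BC_def exact_delbar_def by blast
  have delbar_A: "exact_delbar A \<subseteq> exact_A A"
    using zero_exact(1)[OF assms] forms_pq_zero[OF assms]
    unfolding exact_delbar_def exact_A_def by (force intro: exI[of _ 0])
  have A_BC: "curvature A h \<in> exact_BC A"
    if "ddbar_lemma A" "h \<in> hermitian_metrics A" "curvature A h \<in> forms_pq A 1 1" "curvature A h \<in> exact_A A" for h
    using that(4) aeppli_exact_imp_del_delbar_exact[OF assms that(1,3) curvature_closed[OF assms that(2)]] that(3)
    unfolding exact_A_def exact_BC_def by blast
  show ?thesis unfolding iff using BC_delbar delbar_A A_BC by blast
qed

end
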